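(* Assume the log-polynomial optimization problem $\max_{x\in K}\sum_{i=1}^m a_i\log p_i(x)$ is concave, i.e. $K$ is a convex set and each $p_i$ is concave on $K$. Let $k\ge d$ and let $y^*$ be an optimizer of its $k$-th order moment relaxation. If $y^*$ satisfies the flat truncation condition $$\operatorname{rank}M_t[y^*]=\operatorname{rank}M_{t-d}[y^*]\quad\text{for some integer } t\in[d,k],$$ then $f_{\max}=f_{\mathrm{mom}}=f_{\mathrm{mom},k}$ and $v^*=(y^*_{e_1},\ldots,y^*_{e_n})$ is a global maximizer of $\sum_{i=1}^m a_i\log p_i(x)$ over $x\in K$.
   Context: Let $n,m\ge 1$ be integers, $a_1,\ldots,a_m>0$ real numbers, $\mathcal{E}$ and $\mathcal{I}$ finite disjoint label sets, and $p_1,\ldots,p_m$, $c_j$ ($j\in\mathcal{E}\cup\mathcal{I}$) real polynomials in $x=(x_1,\ldots,x_n)$. Let $$K=\{x\in\mathbb{R}^n: c_j(x)=0\ (j\in\mathcal{E}),\ c_j(x)\ge 0\ (j\in\mathcal{I})\}.$$ Standing assumption: $p_i\ge 0$ on $K$ for all $i$, and there is $\hat{x}\in K$ with $p_i(\hat{x})>0$ for all $i=1,\ldots,m$. Convention: $\log t=-\infty$ for $t\le 0$. Optimal values are suprema in the extended reals. $f_{\max}$ is the optimal value of maximizing $\sum_{i=1}^m a_i\log p_i(x)$ over $x\in K$. Let $d$ be the maximum of $\lceil\deg(q)/2\rceil$ over all $q\in\{p_1,\ldots,p_m\}\cup\{c_j:j\in\mathcal{E}\cup\mathcal{I}\}$;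 it is understood that $d\ge 1$. For $k\ge 0$ let $\mathbb{N}^n_{k}=\{\alpha\in\mathbb{N}^n:|\alpha|\le k\}$ and $[x]_{k}=(x^\alpha)_{\alpha\in\mathbb{N}^n_{k}}$; $e_i\in\mathbb{N}^n$ is the $i$-th unit vector. For $y=(y_\alpha)\in\mathbb{R}^{\mathbb{N}^n_{2k}}$ and a polynomial $q=\sum_\alpha q_\alpha x^\alpha$ of degree $\le 2k$, put $\langle q,y\rangle=\sum_\alpha q_\alpha y_\alpha$. For $t\le k$, $M_t[y]=[y_{\alpha+\beta}]_{\alpha,\beta\in\mathbb{N}^n_t}$ is the $t$-th order moment matrix. For $\deg q\le 2k$ and $s=k-\lceil\deg(q)/2\rceil$, the localizing matrix $L_q^{(k)}[y]$ is obtained by applying the linear map $x^\alpha\mapsto y_\alpha$ entrywise to $q(x)[x]_s[x]_s^T$. Define $$\mathscr{R}_d(K)=\Big\{\sum_{j=1}^l\lambda_j[v_j]_{2d}:\lambda_j\ge 0,\ v_j\in K,\ l\in\mathbb{N}\Big\},$$ and let $f_{\mathrm{mom}}$ be the optimal value of maximizing $\sum_{i=1}^m a_i\log\langle p_i,z\rangle$ subject to $z_0=1$, $z\in\mathscr{R}_d(K)$. For $k\ge d$, the $k$-th order moment relaxation is to maximize $\sum_{i=1}^m a_i\log\langle p_i,y\rangle$ over $y\in\mathbb{R}^{\mathbb{N}^n_{2k}}$ subject to $y_0=1$, $M_k[y]\succeq 0$, $L_{c_j}^{(k)}[y]=0$ ($j\in\mathcal{E}$), $L_{c_j}^{(k)}[y]\succeq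 0$ ($j\in\mathcal{I}$); its optimal value is $f_{\mathrm{mom},k}$. *)

theory Defs
  imports
    "HOL-Analysis.Analysis"
    "HOL-Library.FuncSet"
    "HOL-Library.Function_Algebras"
    "HOL-Library.Poly_Mapping"
begin

section \<open>Multivariate real polynomials\<close>

text \<open>
  The finite type \<open>'n\<close> indexes the variables, so \<open>n = CARD('n)\<close>. Exponents are finitely
  supported maps, and polynomials are finitely supported coefficient maps on exponents; their
  ring structure is the convolution product of \<^theory>\<open>HOL-Library.Poly_Mapping\<close>.
\<close>

type_synonym 'n expo = "'n \<Rightarrow>\<^sub>0 nat"
type_synonym 'n rpoly = "'n expo \<Rightarrow>\<^sub>0 real"

definition expo_deg :: "'n::finite expo \<Rightarrow> nat" where
  "expo_deg \<alpha> = (\<Sum>i\<in>UNIV. Poly_Mapping.lookup \<alpha> i)"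

definition expos_upto :: "nat \<Rightarrow> 'n::finite expo set" where
  "expos_upto k = {\<alpha>. expo_deg \<alpha> \<le> k}"

definition unit_expo :: "'n \<Rightarrow> 'n expo" where
  "unit_expo i = Poly_Mapping.single i 1"

definition mono_eval :: "real ^ 'n::finite \<Rightarrow> 'n expo \<Rightarrow> real" where
  "mono_eval x \<alpha> = (\<Prod>i\<in>UNIV. (x $ i) ^ Poly_Mapping.lookup \<alpha> i)"

definition poly_eval :: "'n::finite rpoly \<Rightarrow> real ^ 'n \<Rightarrow> real" where
  "poly_eval q x = (\<Sum>\<alpha>\<in>Poly_Mapping.keys q. Poly_Mapping.lookup q \<alpha> * mono_eval x \<alpha>)"

text \<open>The zero polynomial gets degree 0.\<close>

definition poly_deg :: "'n::finite rpoly \<Rightarrow> nat" where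
  "poly_deg q = Max (insert 0 (expo_deg ` Poly_Mapping.keys q))"

definition half_deg :: "'n::finite rpoly \<Rightarrow> nat" where
  "half_deg q = nat \<lceil>real (poly_deg q) / 2\<rceil>"

section \<open>Matrices indexed by finite sets\<close>

text \<open>
  A matrix with rows and columns indexed by a finite set \<open>I\<close> is a binary function, of which
  only the entries in \<open>I \<times> I\<close> matter.
\<close>

lemma vector_space_fun: "vector_space (\<lambda>(c::real) (f::'i \<Rightarrow> real) \<alpha>. c * f \<alpha>)"
  by unfold_locales (auto simp: fun_eq_iff algebra_simps)

definition mat_rank :: "'i set \<Rightarrow> ('i \<Rightarrow> 'i \<Rightarrow> real) \<Rightarrow> nat" where
  "mat_rank I A = vector_space.dim (\<lambda>(c::real) (f::'i \<Rightarrow> real) \<alpha>. c * f \<alpha>)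
     ((\<lambda>\<beta> \<alpha>. if \<alpha> \<in> I then A \<alpha> \<beta> else 0) ` I)"

definition mat_psd :: "'i set \<Rightarrow> ('i \<Rightarrow> 'i \<Rightarrow> real) \<Rightarrow> bool" where
  "mat_psd I A \<longleftrightarrow> (\<forall>\<alpha>\<in>I. \<forall>\<beta>\<in>I. A \<alpha> \<beta> = A \<beta> \<alpha>) \<and>
     (\<forall>u. (\<Sum>\<alpha>\<in>I. \<Sum>\<beta>\<in>I. u \<alpha> * A \<alpha> \<beta> * u \<beta>) \<ge> 0)"

definition mat_zero :: "'i set \<Rightarrow> ('i \<Rightarrow> 'i \<Rightarrow> real) \<Rightarrow> bool" where
  "mat_zero I A \<longleftrightarrow> (\<forall>\<alpha>\<in>I. \<forall>\<beta>\<in>I. A \<alpha> \<beta> = 0)"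

section \<open>Truncated moment sequences\<close>

text \<open>
  The space of truncated moment sequences of degree \<open>k\<close> is represented by the functions on
  exponents that are extensional on \<open>expos_upto k\<close>, so that such a sequence is determined by
  its entries of degree at most \<open>k\<close>.
\<close>

definition tms :: "nat \<Rightarrow> ('n::finite expo \<Rightarrow> real) set" where
  "tms k = extensional (expos_upto k)"

definition moment_vec :: "nat \<Rightarrow> real ^ 'n::finite \<Rightarrow> 'n expo \<Rightarrow> real" where
  "moment_vec k x = restrict (mono_eval x) (expos_upto k)"

definition riesz :: "'n::finite rpoly \<Rightarrow> ('n expo \<Rightarrow> real) \<Rightarrow> real" where
  "riesz q y = (\<Sum>\<alpha>\<in>Poly_Mapping.keys q. Poly_Mapping.lookup q \<alpha> * y \<alpha>)"

definition moment_mat :: "('n::finite expo \<Rightarrow> real) \<Rightarrow> 'n expo \<Rightarrow> 'n expo \<Rightarrow> real" where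
  "moment_mat y \<alpha> \<beta> = y (\<alpha> + \<beta>)"

text \<open>
  The localizing matrix of \<open>q\<close> in order \<open>k\<close> is \<open>loc_mat q y\<close> on the index set
  \<open>expos_upto (k - half_deg q)\<close>.
\<close>

definition loc_mat :: "'n::finite rpoly \<Rightarrow> ('n expo \<Rightarrow> real) \<Rightarrow> 'n expo \<Rightarrow> 'n expo \<Rightarrow> real" where
  "loc_mat q y \<alpha> \<beta> = riesz (q * Poly_Mapping.single \<alpha> 1 * Poly_Mapping.single \<beta> 1) y"

definition moment_cone :: "nat \<Rightarrow> (real ^ 'n::finite) set \<Rightarrow> ('n expo \<Rightarrow> real) set" where
  "moment_cone d K =
     {restrict (\<lambda>\<alpha>. \<Sum>j=1..l. w j * moment_vec (2 * d) (v j) \<alpha>) (expos_upto (2 * d)) | w v (l::nat).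
        \<forall>j\<in>{1..l}. w j \<ge> (0::real) \<and> v j \<in> K}"

section \<open>Log-polynomial optimization and its moment relaxations\<close>

definition log_ext :: "real \<Rightarrow> ereal" where
  "log_ext t = (if t \<le> 0 then - \<infinity> else ereal (ln t))"

definition log_sum :: "nat \<Rightarrow> (nat \<Rightarrow> real) \<Rightarrow> (nat \<Rightarrow> real) \<Rightarrow> ereal" where
  "log_sum m a w = (\<Sum>i=1..m. ereal (a i) * log_ext (w i))"

definition feas_set :: "'l set \<Rightarrow> 'l set \<Rightarrow> ('l \<Rightarrow> 'n::finite rpoly) \<Rightarrow> (real ^ 'n) set" where
  "feas_set E I c =
     {x. (\<forall>j\<in>E. poly_eval (c j) x = 0) \<and> (\<forall>j\<in>I. poly_eval (c j) x \<ge> 0)}"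

text \<open>The entry 1 only matters if all polynomials are constant; it makes the order at least 1.\<close>

definition rel_deg ::
  "nat \<Rightarrow> (nat \<Rightarrow> 'n::finite rpoly) \<Rightarrow> 'l set \<Rightarrow> 'l set \<Rightarrow> ('l \<Rightarrow> 'n rpoly) \<Rightarrow> nat" where
  "rel_deg m p E I c = Max (insert 1 (half_deg ` (p ` {1..m} \<union> c ` (E \<union> I))))"

definition log_poly_obj ::
  "nat \<Rightarrow> (nat \<Rightarrow> real) \<Rightarrow> (nat \<Rightarrow> 'n::finite rpoly) \<Rightarrow> real ^ 'n \<Rightarrow> ereal" where
  "log_poly_obj m a p x = log_sum m a (\<lambda>i. poly_eval (p i) x)"

definition log_mom_obj ::
  "nat \<Rightarrow> (nat \<Rightarrow> real) \<Rightarrow> (nat \<Rightarrow> 'n::finite rpoly) \<Rightarrow> ('n expo \<Rightarrow> real) \<Rightarrow> ereal" where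
  "log_mom_obj m a p y = log_sum m a (\<lambda>i. riesz (p i) y)"

definition f_max ::
  "nat \<Rightarrow> (nat \<Rightarrow> real) \<Rightarrow> (nat \<Rightarrow> 'n::finite rpoly) \<Rightarrow> 'l set \<Rightarrow> 'l set \<Rightarrow> ('l \<Rightarrow> 'n rpoly) \<Rightarrow> ereal" where
  "f_max m a p E I c = (SUP x\<in>feas_set E I c. log_poly_obj m a p x)"

definition mom_feas ::
  "nat \<Rightarrow> (nat \<Rightarrow> 'n::finite rpoly) \<Rightarrow> 'l set \<Rightarrow> 'l set \<Rightarrow> ('l \<Rightarrow> 'n rpoly) \<Rightarrow> ('n expo \<Rightarrow> real) set" where
  "mom_feas m p E I c = {z \<in> moment_cone (rel_deg m p E I c) (feas_set E I c). z 0 = 1}"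

definition f_mom ::
  "nat \<Rightarrow> (nat \<Rightarrow> real) \<Rightarrow> (nat \<Rightarrow> 'n::finite rpoly) \<Rightarrow> 'l set \<Rightarrow> 'l set \<Rightarrow> ('l \<Rightarrow> 'n rpoly) \<Rightarrow> ereal" where
  "f_mom m a p E I c = (SUP z\<in>mom_feas m p E I c. log_mom_obj m a p z)"

definition rel_feas ::
  "'l set \<Rightarrow> 'l set \<Rightarrow> ('l \<Rightarrow> 'n::finite rpoly) \<Rightarrow> nat \<Rightarrow> ('n expo \<Rightarrow> real) set" where
  "rel_feas E I c k =
     {y \<in> tms (2 * k). y 0 = 1 \<and> mat_psd (expos_upto k) (moment_mat y) \<and>
        (\<forall>j\<in>E. mat_zero (expos_upto (k - half_deg (c j))) (loc_mat (c j) y)) \<and>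
        (\<forall>j\<in>I. mat_psd (expos_upto (k - half_deg (c j))) (loc_mat (c j) y))}"

definition f_mom_rel ::
  "nat \<Rightarrow> (nat \<Rightarrow> real) \<Rightarrow> (nat \<Rightarrow> 'n::finite rpoly) \<Rightarrow> 'l set \<Rightarrow> 'l set \<Rightarrow> ('l \<Rightarrow> 'n rpoly) \<Rightarrow> nat \<Rightarrow> ereal" where
  "f_mom_rel m a p E I c k = (SUP y\<in>rel_feas E I c k. log_mom_obj m a p y)"

definition flat_trunc :: "nat \<Rightarrow> nat \<Rightarrow> ('n::finite expo \<Rightarrow> real) \<Rightarrow> bool" where
  "flat_trunc d k y \<longleftrightarrow> (\<exists>t\<in>{d..k}.
     mat_rank (expos_upto t) (moment_mat y) = mat_rank (expos_upto (t - d)) (moment_mat y))"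

end

theory Submission
  imports Defs
begin

text \<open>
  Why a flat optimizer solves the original problem: flatness forces the moment sequence
  \<open>ystar\<close> to be, up to degree \<open>2 * t\<close>, a convex combination of moment vectors of points
  \<open>v q\<close> of the feasible set \<open>K\<close> (\<open>flat_moment_atoms_feasible\<close>). Its first-order part is then the
  barycentre \<open>vstar\<close> of these points, which lies in \<open>K\<close> by convexity, and Jensen's inequality for
  the concave \<open>p i\<close> says that passing from \<open>ystar\<close> to \<open>vstar\<close> does not decrease the objective
  (\<open>jensen_log_mom_obj\<close>). Point evaluations are feasible for the relaxation, so its value is
  at least that of the original problem, and the chain of inequalities closes. The same
  Jensen inequality, applied to an arbitrary point of the moment cone, shows that the moment
  problem cannot exceed the original one either.

  The atoms come from linear algebra alone. The moment matrix \<open>M\<close> of order \<open>t\<close> is positive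
  semidefinite, hence a Gram matrix \<open>y (\<alpha> + \<beta>) = \<langle>w \<alpha>, w \<beta>\<rangle>\<close>; flatness says that the vectors
  \<open>w \<beta>\<close> with \<open>expo_deg \<beta> \<le> t - d\<close> already span the space (\<open>flat_psd_gram\<close>). In this space
  multiplication by the \<open>i\<close>-th variable, \<open>w \<beta> \<mapsto> w (\<beta> + unit_expo i)\<close>, is a symmetric operator, and
  these operators commute, because \<open>\<langle>w \<alpha>, w \<beta>\<rangle>\<close> only depends on \<open>\<alpha> + \<beta>\<close>. Commuting symmetric
  operators have a common orthonormal eigenbasis (\<open>simultaneous_diagonalization\<close>). The
  eigenvalues along a basis vector are the coordinates of an atom, the squared component of
  \<open>w 0\<close> is its weight, and Parseval's identity is the representation of \<open>y\<close>
  (\<open>flat_moment_atoms\<close>).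

  Each basis vector is moreover represented by a polynomial of degree at most \<open>t - d\<close>, which
  vanishes at every atom but one. Testing the localizing matrices with these polynomials
  isolates the value of each constraint at each atom, which gives feasibility.
\<close>

section \<open>Simultaneous diagonalization of commuting symmetric matrices\<close>

definition inner_on :: "'i set \<Rightarrow> ('i \<Rightarrow> real) \<Rightarrow> ('i \<Rightarrow> real) \<Rightarrow> real" where
  "inner_on I f g = (\<Sum>i\<in>I. f i * g i)"

text \<open>
  The value 0 outside \<open>I\<close> allows eigenvector equations to be stated as equalities of functions.
\<close>

definition mat_app :: "'i set \<Rightarrow> ('i \<Rightarrow> 'i \<Rightarrow> real) \<Rightarrow> ('i \<Rightarrow> real) \<Rightarrow> 'i \<Rightarrow> real" where
  "mat_app I A f = (\<lambda>i. if i \<in> I then \<Sum>j\<in>I. A i j * f j else 0)"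

definition mat_sym :: "'i set \<Rightarrow> ('i \<Rightarrow> 'i \<Rightarrow> real) \<Rightarrow> bool" where
  "mat_sym I A \<longleftrightarrow> (\<forall>i\<in>I. \<forall>j\<in>I. A i j = A j i)"

definition mat_comm :: "'i set \<Rightarrow> ('i \<Rightarrow> 'i \<Rightarrow> real) \<Rightarrow> ('i \<Rightarrow> 'i \<Rightarrow> real) \<Rightarrow> bool" where
  "mat_comm I A B \<longleftrightarrow> (\<forall>i\<in>I. \<forall>j\<in>I. (\<Sum>k\<in>I. A i k * B k j) = (\<Sum>k\<in>I. B i k * A k j))"

lemma inner_on_cong: "(\<And>i. i \<in> I \<Longrightarrow> f i = f' i) \<Longrightarrow> (\<And>i. i \<in> I \<Longrightarrow> g i = g' i) \<Longrightarrow> inner_on I f g = inner_on I f' g'"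
  by (simp add: inner_on_def)

lemma inner_on_commute: "inner_on I f g = inner_on I g f"
  by (simp add: inner_on_def mult.commute)

lemma inner_on_lin_left: "inner_on I (\<lambda>i. a * f i + b * g i) h = a * inner_on I f h + b * inner_on I g h"
  by (simp add: inner_on_def sum.distrib sum_distrib_left algebra_simps)

lemma inner_on_lin_right: "inner_on I h (\<lambda>i. a * f i + b * g i) = a * inner_on I h f + b * inner_on I h g"
  by (simp add: inner_on_def sum.distrib sum_distrib_left algebra_simps)

lemma inner_on_sum_left: "inner_on I (\<lambda>i. \<Sum>h\<in>H. c h * f h i) g = (\<Sum>h\<in>H. c h * inner_on I (f h) g)"
  unfolding inner_on_def sum_distrib_left sum_distrib_right
  by (subst sum.swap) (simp add: mult.assoc)

lemma inner_on_sum_right: "inner_on I g (\<lambda>i. \<Sum>h\<in>H. c h * f h i) = (\<Sum>h\<in>H. c h * inner_on I g (f h))"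
  by (simp add: inner_on_commute[of I g] inner_on_sum_left)

lemma inner_on_nonneg: "0 \<le> inner_on I f f"
  by (simp add: inner_on_def sum_nonneg)

lemma inner_on_self_eq_0: "finite I \<Longrightarrow> inner_on I f f = 0 \<longleftrightarrow> (\<forall>i\<in>I. f i = 0)"
  by (simp add: inner_on_def sum_nonneg_eq_0_iff)

lemma mat_app_outside: "i \<notin> I \<Longrightarrow> mat_app I A f i = 0"
  by (simp add: mat_app_def)

lemma mat_app_lin:
  "mat_app I A (\<lambda>i. a * f i + b * g i) = (\<lambda>i. a * mat_app I A f i + b * mat_app I A g i)"
  by (simp add: mat_app_def fun_eq_iff sum.distrib sum_distrib_left algebra_simps)

lemma mat_app_sum:
  "mat_app I A (\<lambda>i. \<Sum>h\<in>H. c h * f h i) = (\<lambda>i. \<Sum>h\<in>H. c h * mat_app I A (f h) i)"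
proof
  fix i
  have "(\<Sum>j\<in>I. A i j * (\<Sum>h\<in>H. c h * f h j)) = (\<Sum>h\<in>H. c h * (\<Sum>j\<in>I. A i j * f h j))"
    unfolding sum_distrib_left by (subst sum.swap) (simp add: mult.left_commute)
  then show "mat_app I A (\<lambda>i. \<Sum>h\<in>H. c h * f h i) i = (\<Sum>h\<in>H. c h * mat_app I A (f h) i)"
    by (simp add: mat_app_def)
qed

lemma inner_on_mat_app_sym:
  assumes "mat_sym I A"
  shows "inner_on I (mat_app I A f) g = inner_on I f (mat_app I A g)"
proof -
  have "inner_on I (mat_app I A f) g = (\<Sum>i\<in>I. \<Sum>j\<in>I. A i j * f j * g i)"
    by (simp add: inner_on_def mat_app_def sum_distrib_right)
  also have "\<dots> = (\<Sum>j\<in>I. \<Sum>i\<in>I. A i j * f j * g i)"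
    by (rule sum.swap)
  also have "\<dots> = inner_on I f (mat_app I A g)"
    using assms
    by (auto simp: inner_on_def mat_app_def mat_sym_def sum_distrib_left algebra_simps intro!: sum.cong)
  finally show ?thesis .
qed

lemma mat_app_compose:
  "i \<in> I \<Longrightarrow> mat_app I A (mat_app I B f) i = (\<Sum>j\<in>I. (\<Sum>k\<in>I. A i k * B k j) * f j)"
  unfolding mat_app_def sum_distrib_left sum_distrib_right
  by (simp add: sum_distrib_left mult.assoc) (rule sum.swap)

lemma mat_app_comm:
  assumes "mat_comm I A B"
  shows "mat_app I A (mat_app I B f) = mat_app I B (mat_app I A f)"
proof
  fix i
  show "mat_app I A (mat_app I B f) i = mat_app I B (mat_app I A f) i"
  proof (cases "i \<in> I")
    case True
    then show ?thesis
      using assms by (simp add: mat_app_compose mat_comm_def)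
  qed (simp add: mat_app_def)
qed

text \<open>
  If a nonnegative quadratic form vanishes at \<open>u\<close>, then on the line \<open>u + s * g\<close> it is
  \<open>2 * s * b + s\<^sup>2 * c\<close>, where \<open>b\<close> is the bilinear form at \<open>u\<close> and \<open>g\<close>. The claim is thus the
  first-order condition at the minimum \<open>u\<close>.
\<close>

lemma linear_coeff_zero_if_nonneg:
  fixes b c :: real
  assumes "\<And>s. 2 * s * b + s\<^sup>2 * c \<ge> 0"
  shows "b = 0"
proof -
  have "c \<ge> 0" using assms[of 1] assms[of "-1"] by simp
  have "2 * (- b / (c + 1)) * b + (- b / (c + 1))\<^sup>2 * c = - (b\<^sup>2 * (c + 2)) / (c + 1)\<^sup>2"
    using \<open>c \<ge> 0\<close> by (simp add: divide_simps power2_eq_square) (simp add: algebra_simps)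
  with assms[of "- b / (c + 1)"] have "b\<^sup>2 * (c + 2) / (c + 1)\<^sup>2 \<le> 0" by simp
  then have "b\<^sup>2 * (c + 2) \<le> 0" using \<open>c \<ge> 0\<close> by (simp add: divide_le_0_iff)
  then show ?thesis using \<open>c \<ge> 0\<close> by (simp add: mult_le_0_iff)
qed

lemma continuous_on_ip:
  fixes f g :: "('i \<Rightarrow> real) \<Rightarrow> 'i \<Rightarrow> real"
  assumes "\<And>i. i \<in> I \<Longrightarrow> continuous_on UNIV (\<lambda>x. f x i)"
    and "\<And>i. i \<in> I \<Longrightarrow> continuous_on UNIV (\<lambda>x. g x i)"
  shows "continuous_on UNIV (\<lambda>x. inner_on I (f x) (g x))"
  unfolding inner_on_def using assms by (intro continuous_on_sum continuous_on_mult) auto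

text \<open>
  The index set is a finite part of an arbitrary type, so the sphere lives in a possibly
  infinite product of lines; it is compact there by Tychonoff's theorem, since all but
  finitely many coordinates are confined to the point 0.
\<close>

lemma compact_unit_sphere:
  fixes I :: "'i set" and S :: "('i \<Rightarrow> real) set"
  assumes "finite I"
  shows "compact {f. (\<forall>i. i \<notin> I \<longrightarrow> f i = 0) \<and> (\<forall>s\<in>S. inner_on I f s = 0) \<and> inner_on I f f = 1}"
    (is "compact ?T")
proof -
  let ?C = "\<lambda>i. if i \<in> I then {-1..1::real} else {0}"
  let ?B = "PiE UNIV ?C"
  have "compactin (product_topology (\<lambda>i::'i. euclidean) UNIV) ?B"
    by (simp add: compactin_PiE)
  then have "compact ?B"
    by (simp add: euclidean_product_topology)
  moreover have "closed ?T"
  proof -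
    have c: "continuous_on UNIV (\<lambda>f. f i :: real)" for i :: 'i
      by simp
    have "closed {f::'i \<Rightarrow> real. i \<notin> I \<longrightarrow> f i = 0}" for i
      by (cases "i \<in> I") (auto intro!: closed_Collect_eq c continuous_on_const)
    moreover have "closed {f. s \<in> S \<longrightarrow> inner_on I f s = 0}" for s
      by (cases "s \<in> S") (auto intro!: closed_Collect_eq c continuous_on_const continuous_on_ip)
    moreover have "closed {f. inner_on I f f = 1}"
      by (auto intro!: closed_Collect_eq c continuous_on_const continuous_on_ip)
    ultimately show ?thesis
      unfolding Ball_def by (intro closed_Collect_conj closed_Collect_all)
  qed
  moreover have "?T \<subseteq> ?B"
  proof
    fix f assume f: "f \<in> ?T"
    have "\<bar>f i\<bar> \<le> 1" if "i \<in> I" for i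
    proof -
      have "(f i)\<^sup>2 \<le> (\<Sum>j\<in>I. (f j)\<^sup>2)"
        using that assms by (intro member_le_sum) auto
      also have "\<dots> = 1" using f by (simp add: inner_on_def power2_eq_square)
      finally show ?thesis by (simp add: abs_square_le_1)
    qed
    with f show "f \<in> ?B" by (auto simp: abs_le_iff)
  qed
  ultimately show ?thesis
    using compact_Int_closed[of ?B ?T] by (simp add: Int_absorb1)
qed

text \<open>
  A variational proof that finds the common eigenvector in one step, without iterating over
  eigenspaces. Let \<open>\<Phi> f\<close> be the vector of the numbers \<open>\<langle>A h f, f\<rangle>\<close>. Among the unit vectors
  orthogonal to \<open>S\<close>, let \<open>u\<close> maximize the Euclidean length of \<open>\<Phi>\<close>, and put \<open>v = \<Phi> u\<close>.
  By Cauchy--Schwarz \<open>\<langle>v, \<Phi> f\<rangle> \<le> \<bar>v\<bar>\<^sup>2 * \<langle>f, f\<rangle>\<close>, so the operator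
  \<open>D = \<bar>v\<bar>\<^sup>2 - (\<Sum>h. v h * A h)\<close> is positive semidefinite, and \<open>\<langle>D u, u\<rangle> = 0\<close>, hence \<open>D u = 0\<close>.
  On the kernel of \<open>D\<close> the Cauchy--Schwarz inequality is an equality, which forces
  \<open>\<Phi> f = \<langle>f, f\<rangle> * v\<close>; the kernel is invariant under every \<open>A h\<close>, as these commute with \<open>D\<close>, so by
  polarization \<open>A h\<close> acts on it as the scalar \<open>v h\<close>.
\<close>

lemma common_eigenvector:
  fixes A :: "'h::finite \<Rightarrow> 'i \<Rightarrow> 'i \<Rightarrow> real"
  assumes fin: "finite I"
    and sym: "\<And>h. mat_sym I (A h)"
    and comm: "\<And>g h. mat_comm I (A g) (A h)"
    and eig: "\<And>s h. s \<in> S \<Longrightarrow> \<exists>e. mat_app I (A h) s = (\<lambda>i. e * s i)"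
    and f0: "\<And>i. i \<notin> I \<Longrightarrow> f i = 0" "\<And>s. s \<in> S \<Longrightarrow> inner_on I f s = 0" "inner_on I f f \<noteq> 0"
  shows "\<exists>u v. (\<forall>i. i \<notin> I \<longrightarrow> u i = 0) \<and> (\<forall>s\<in>S. inner_on I u s = 0) \<and> inner_on I u u = 1 \<and>
    (\<forall>h. mat_app I (A h) u = (\<lambda>i. v h * u i))"
proof -
  define W where "W = {f. (\<forall>i. i \<notin> I \<longrightarrow> f i = 0) \<and> (\<forall>s\<in>S. inner_on I f s = 0)}"
  define \<Phi> where "\<Phi> h f = inner_on I (mat_app I (A h) f) f" for h f
  define T where "T = {f. (\<forall>i. i \<notin> I \<longrightarrow> f i = 0) \<and> (\<forall>s\<in>S. inner_on I f s = 0) \<and> inner_on I f f = 1}"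
  have T_iff: "g \<in> T \<longleftrightarrow> g \<in> W \<and> inner_on I g g = 1" for g
    by (auto simp: T_def W_def)
  have W_lin: "(\<lambda>i. a * g i + b * g' i) \<in> W" if "g \<in> W" "g' \<in> W" for a b g g'
    using that by (simp add: W_def inner_on_lin_left)
  have W_app: "mat_app I (A h) g \<in> W" if "g \<in> W" for g h
  proof -
    have "inner_on I (mat_app I (A h) g) s = 0" if s: "s \<in> S" for s
    proof -
      obtain e where "mat_app I (A h) s = (\<lambda>i. e * s i)" using eig[OF s] by blast
      then have "inner_on I (mat_app I (A h) g) s = inner_on I g (\<lambda>i. e * s i + 0 * s i)"
        by (simp add: inner_on_mat_app_sym[OF sym])
      also have "\<dots> = 0" using \<open>g \<in> W\<close> s unfolding inner_on_lin_right by (simp add: W_def)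
      finally show ?thesis .
    qed
    then show ?thesis by (simp add: W_def mat_app_outside)
  qed
  have zeroI: "g = (\<lambda>i. 0)" if "g \<in> W" "inner_on I g g = 0" for g
    using that by (auto simp: W_def fun_eq_iff inner_on_self_eq_0[OF fin])
  have norm: "\<exists>g' \<in> T. \<exists>r. inner_on I g g = r\<^sup>2 \<and> g = (\<lambda>i. r * g' i)" if g: "g \<in> W" "inner_on I g g \<noteq> 0" for g
  proof -
    define r where "r = sqrt (inner_on I g g)"
    have r: "r > 0" "r\<^sup>2 = inner_on I g g"
      using inner_on_nonneg[of I g] g by (auto simp: r_def)
    let ?g = "\<lambda>i. (1/r) * g i + 0 * g i"
    have "inner_on I ?g ?g = 1"
      unfolding inner_on_lin_left inner_on_lin_right using r g(2) by (simp add: r(2)[symmetric] power2_eq_square)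
    moreover have "?g \<in> W" using g(1) by (intro W_lin)
    ultimately have "?g \<in> T" by (simp add: T_iff)
    then show ?thesis
      using r by (intro bexI[of _ ?g] exI[of _ r]) auto
  qed
  have "f \<in> W" using f0 by (simp add: W_def)
  then have "T \<noteq> {}" using norm f0(3) by blast
  have cont: "continuous_on T (\<lambda>f. \<Sum>h\<in>UNIV. (\<Phi> h f)\<^sup>2)"
  proof -
    have "continuous_on UNIV (\<lambda>f. \<Sum>h\<in>UNIV. (\<Phi> h f)\<^sup>2)"
      unfolding \<Phi>_def
      by (intro continuous_on_sum continuous_on_power continuous_on_ip)
         (auto simp: mat_app_def intro!: continuous_intros)
    then show ?thesis by (rule continuous_on_subset) simp
  qed
  obtain u where u: "u \<in> T" and umax: "\<And>g. g \<in> T \<Longrightarrow> (\<Sum>h\<in>UNIV. (\<Phi> h g)\<^sup>2) \<le> (\<Sum>h\<in>UNIV. (\<Phi> h u)\<^sup>2)"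
    using continuous_attains_sup[OF _ \<open>T \<noteq> {}\<close> cont] compact_unit_sphere[OF fin, of S]
    by (auto simp: T_def)
  define v where "v h = \<Phi> h u" for h
  define N where "N = (\<Sum>h\<in>UNIV. (v h)\<^sup>2)"
  have uW: "u \<in> W" and u1: "inner_on I u u = 1" using u by (auto simp: T_iff)
  have bound: "(\<Sum>h\<in>UNIV. (\<Phi> h g)\<^sup>2) \<le> N * (inner_on I g g)\<^sup>2" if g: "g \<in> W" for g
  proof (cases "inner_on I g g = 0")
    case True
    with zeroI g have "g = (\<lambda>i. 0)" by blast
    then show ?thesis by (simp add: \<Phi>_def inner_on_def)
  next
    case False
    obtain g' r where g': "g' \<in> T" and r: "inner_on I g g = r\<^sup>2" "g = (\<lambda>i. r * g' i)"
      using norm[OF g False] by blast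
    have "\<Phi> h g = r\<^sup>2 * \<Phi> h g'" for h
      using mat_app_lin[of I "A h" r g' 0 g'] inner_on_lin_left[of I r _ 0] inner_on_lin_right[of I _ r g' 0 g']
      by (simp add: \<Phi>_def r(2) power2_eq_square)
    then have "(\<Sum>h\<in>UNIV. (\<Phi> h g)\<^sup>2) = (r\<^sup>2)\<^sup>2 * (\<Sum>h\<in>UNIV. (\<Phi> h g')\<^sup>2)"
      by (simp add: power_mult_distrib sum_distrib_left)
    also have "\<dots> \<le> (r\<^sup>2)\<^sup>2 * N"
      unfolding N_def v_def by (intro mult_left_mono umax g') auto
    finally show ?thesis by (simp add: r(1) mult.commute)
  qed
  define D where "D g = (\<lambda>i. N * g i + (-1) * (\<Sum>h\<in>UNIV. v h * mat_app I (A h) g i))" for g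
  have ipD: "inner_on I (D g) g' = N * inner_on I g g' - (\<Sum>h\<in>UNIV. v h * inner_on I (mat_app I (A h) g) g')" for g g'
    unfolding D_def inner_on_lin_left inner_on_sum_left by simp
  have ipD_sym: "inner_on I (D g) g' = inner_on I (D g') g" for g g'
    unfolding ipD by (simp add: inner_on_commute[of I g'] inner_on_mat_app_sym[OF sym])
  have D_lin: "D (\<lambda>i. a * g i + b * g' i) = (\<lambda>i. a * D g i + b * D g' i)" for a b g g'
    by (simp add: D_def mat_app_lin fun_eq_iff sum.distrib sum_distrib_left algebra_simps)
  have D_app: "D (mat_app I (A h) g) = mat_app I (A h) (D g)" for h g
    unfolding D_def mat_app_lin mat_app_sum by (simp add: mat_app_comm[OF comm, of h])
  have D_W: "D g \<in> W" if "g \<in> W" for g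
  proof -
    have "D g i = 0" if "i \<notin> I" for i
      using \<open>g \<in> W\<close> that by (simp add: D_def W_def mat_app_outside)
    moreover have "inner_on I (D g) s = 0" if "s \<in> S" for s
      using \<open>g \<in> W\<close> that W_app[OF \<open>g \<in> W\<close>] by (simp add: ipD W_def)
    ultimately show ?thesis by (simp add: W_def)
  qed
  have D_psd: "inner_on I (D g) g \<ge> 0" if "g \<in> W" for g
  proof -
    have "N \<ge> 0" by (simp add: N_def sum_nonneg)
    have "(\<Sum>h\<in>UNIV. v h * \<Phi> h g)\<^sup>2 \<le> N * (\<Sum>h\<in>UNIV. (\<Phi> h g)\<^sup>2)"
      unfolding N_def by (rule Cauchy_Schwarz_ineq_sum)
    also have "\<dots> \<le> N * (N * (inner_on I g g)\<^sup>2)"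
      by (intro mult_left_mono bound that \<open>N \<ge> 0\<close>)
    also have "\<dots> = (N * inner_on I g g)\<^sup>2" by (simp add: power2_eq_square)
    finally have "(\<Sum>h\<in>UNIV. v h * \<Phi> h g) \<le> N * inner_on I g g"
      by (rule power2_le_imp_le) (simp add: \<open>N \<ge> 0\<close> inner_on_nonneg)
    then show ?thesis by (simp add: ipD \<Phi>_def)
  qed
  have D_u: "inner_on I (D u) u = 0"
    unfolding ipD u1 by (simp add: N_def v_def \<Phi>_def power2_eq_square)
  have "inner_on I (D u) (D u) = 0"
  proof (rule linear_coeff_zero_if_nonneg)
    fix s
    have "0 \<le> inner_on I (D (\<lambda>i. 1 * u i + s * D u i)) (\<lambda>i. 1 * u i + s * D u i)"
      by (intro D_psd W_lin uW D_W)
    also have "\<dots> = 2 * s * inner_on I (D u) (D u) + s\<^sup>2 * inner_on I (D (D u)) (D u)"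
      using D_u ipD_sym[of "D u" u] unfolding D_lin inner_on_lin_left inner_on_lin_right
      by (simp add: power2_eq_square algebra_simps)
    finally show "0 \<le> 2 * s * inner_on I (D u) (D u) + s\<^sup>2 * inner_on I (D (D u)) (D u)" .
  qed
  then have Du0: "D u = (\<lambda>i. 0)" using zeroI D_W uW by blast
  have scalar: "\<Phi> h g = v h * inner_on I g g" if g: "g \<in> W" "D g = (\<lambda>i. 0)" for g h
  proof -
    have "(\<Sum>h\<in>UNIV. v h * \<Phi> h g) = N * inner_on I g g"
      using ipD[of g g] g by (simp add: \<Phi>_def) (simp add: inner_on_def)
    moreover have "(\<Sum>h\<in>UNIV. (\<Phi> h g - v h * inner_on I g g)\<^sup>2) = (\<Sum>h\<in>UNIV. (\<Phi> h g)\<^sup>2)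
        - 2 * inner_on I g g * (\<Sum>h\<in>UNIV. v h * \<Phi> h g) + N * (inner_on I g g)\<^sup>2"
      unfolding N_def power2_diff sum.distrib sum_subtractf
      by (simp add: sum_distrib_left sum_distrib_right power_mult_distrib mult_ac)
    ultimately have "(\<Sum>h\<in>UNIV. (\<Phi> h g - v h * inner_on I g g)\<^sup>2) \<le> 0"
      using bound[OF g(1)] by (simp add: power2_eq_square algebra_simps)
    then have "(\<Sum>h\<in>UNIV. (\<Phi> h g - v h * inner_on I g g)\<^sup>2) = 0"
      by (intro antisym sum_nonneg) auto
    then show ?thesis by (subst (asm) sum_nonneg_eq_0_iff) auto
  qed
  \<comment> \<open>Both \<open>\<Phi> h\<close> and the squared norm are quadratic forms that agree up to the factor \<open>v h\<close> on the
    kernel of \<open>D\<close>; comparing them at \<open>u + g\<close> compares the bilinear forms.\<close>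
  have polar: "inner_on I (mat_app I (A h) u) g = v h * inner_on I u g" if g: "g \<in> W" "D g = (\<lambda>i. 0)" for g h
  proof -
    let ?s = "\<lambda>i. 1 * u i + 1 * g i"
    have "\<Phi> h ?s = v h * inner_on I ?s ?s"
      using uW Du0 g by (intro scalar W_lin) (simp_all only: D_lin, simp)
    then have "\<Phi> h u + \<Phi> h g + 2 * inner_on I (mat_app I (A h) u) g
        = v h * (inner_on I u u + inner_on I g g + 2 * inner_on I u g)"
      unfolding \<Phi>_def mat_app_lin inner_on_lin_left inner_on_lin_right
      using inner_on_mat_app_sym[OF sym, of h g u] inner_on_commute[of I g u]
        inner_on_commute[of I g "mat_app I (A h) u"]
      by (simp add: algebra_simps)
    then show ?thesis
      using scalar[OF g] scalar[OF uW Du0] by (simp add: algebra_simps)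
  qed
  have "mat_app I (A h) u = (\<lambda>i. v h * u i)" for h
  proof -
    let ?g = "\<lambda>i. 1 * mat_app I (A h) u i + (- v h) * u i"
    have "D ?g = (\<lambda>i. 0)"
      unfolding D_lin D_app Du0 by (simp add: mat_app_def fun_eq_iff)
    moreover have gW: "?g \<in> W" by (intro W_lin W_app uW)
    ultimately have "inner_on I (mat_app I (A h) u) ?g = v h * inner_on I u ?g"
      by (intro polar)
    then have "inner_on I ?g ?g = 0"
      unfolding inner_on_lin_left[of I 1 "mat_app I (A h) u"] by simp
    from zeroI[OF gW this] show ?thesis by (simp add: fun_eq_iff)
  qed
  with uW u1 show ?thesis
    by (intro exI[of _ u] exI[of _ v]) (simp add: W_def)
qed

text \<open>
  An orthonormal family of common eigenvectors of maximal size is complete: otherwise its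
  orthogonal complement contains another common eigenvector. A maximal size exists because
  Bessel's inequality bounds the size by \<open>card I\<close>.
\<close>

theorem simultaneous_diagonalization:
  fixes A :: "'h::finite \<Rightarrow> 'i \<Rightarrow> 'i \<Rightarrow> real"
  assumes fin: "finite I"
    and sym: "\<And>h. mat_sym I (A h)"
    and comm: "\<And>g h. mat_comm I (A g) (A h)"
  obtains U :: "('i \<Rightarrow> real) set" and v :: "('i \<Rightarrow> real) \<Rightarrow> 'h \<Rightarrow> real" where
    "finite U"
    "\<And>u w. u \<in> U \<Longrightarrow> w \<in> U \<Longrightarrow> inner_on I u w = (if u = w then 1 else 0)"
    "\<And>u h. u \<in> U \<Longrightarrow> mat_app I (A h) u = (\<lambda>i. v u h * u i)"
    "\<And>f g. inner_on I f g = (\<Sum>u\<in>U. inner_on I f u * inner_on I g u)"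
proof -
  define good where "good U \<longleftrightarrow> finite U \<and> (\<forall>u\<in>U. \<forall>w\<in>U. inner_on I u w = (if u = w then 1 else 0))
    \<and> (\<forall>u\<in>U. \<forall>i. i \<notin> I \<longrightarrow> u i = 0)
    \<and> (\<forall>u\<in>U. \<exists>v. \<forall>h. mat_app I (A h) u = (\<lambda>i. v h * u i))" for U
  \<comment> \<open>The factors 1 and -1 turn the residual into an instance of the linearity rules.\<close>
  have resid: "inner_on I (\<lambda>i. 1 * f i + (-1) * (\<Sum>u\<in>U. inner_on I f u * u i)) w = 0" if "good U" "w \<in> U" for f U w
  proof -
    have "(\<Sum>u\<in>U. inner_on I f u * inner_on I u w) = (\<Sum>u\<in>U. if u = w then inner_on I f w else 0)"
      using that by (intro sum.cong) (auto simp: good_def)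
    then show ?thesis
      unfolding inner_on_lin_left inner_on_sum_left using that by (simp add: good_def)
  qed
  have resid2: "inner_on I (\<lambda>i. 1 * f i + (-1) * (\<Sum>u\<in>U. inner_on I f u * u i)) g
      = inner_on I f g - (\<Sum>u\<in>U. inner_on I f u * inner_on I g u)" for f g U
    unfolding inner_on_lin_left inner_on_sum_left by (simp add: inner_on_commute[of I _ g])
  have card_le: "card U \<le> card I" if "good U" for U
  proof -
    \<comment> \<open>Bessel's inequality for the \<open>i\<close>-th standard basis vector.\<close>
    have *: "(\<Sum>u\<in>U. (u i)\<^sup>2) \<le> 1" if "i \<in> I" for i
    proof -
      let ?d = "\<lambda>j. if j = i then 1 else 0 :: real"
      let ?r = "\<lambda>j. 1 * ?d j + (-1) * (\<Sum>u\<in>U. inner_on I ?d u * u j)"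
      have d: "inner_on I ?d g = g i" for g
        using that fin by (simp add: inner_on_def if_distrib[of "\<lambda>x. x * _"] cong: if_cong)
      have "0 \<le> inner_on I ?r ?r" by (rule inner_on_nonneg)
      also have "\<dots> = inner_on I ?r ?d"
        using resid[OF \<open>good U\<close>, of _ ?d]
        unfolding inner_on_lin_right[of I ?r 1 ?d] inner_on_sum_right by simp
      also have "\<dots> = 1 - (\<Sum>u\<in>U. (u i)\<^sup>2)"
        using resid2[of ?d U ?d] unfolding d by (simp add: power2_eq_square)
      finally show ?thesis by simp
    qed
    have "real (card U) = (\<Sum>u\<in>U. inner_on I u u)" using that by (simp add: good_def)
    also have "\<dots> = (\<Sum>i\<in>I. \<Sum>u\<in>U. (u i)\<^sup>2)"
      unfolding inner_on_def power2_eq_square by (rule sum.swap)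
    also have "\<dots> \<le> (\<Sum>i\<in>I. 1)" by (intro sum_mono *)
    finally show ?thesis by simp
  qed
  have "good {}" by (simp add: good_def)
  then obtain U where U: "good U" and Umax: "\<And>U'. good U' \<Longrightarrow> card U' \<le> card U"
    using ex_has_greatest_nat[of good "{}" card "Suc (card I)"] card_le by (auto simp: less_Suc_eq_le)
  obtain v where v: "\<And>u h. u \<in> U \<Longrightarrow> mat_app I (A h) u = (\<lambda>i. v u h * u i)"
    using U unfolding good_def by metis
  have complete: "inner_on I f f = 0" if f: "\<And>i. i \<notin> I \<Longrightarrow> f i = 0" "\<And>s. s \<in> U \<Longrightarrow> inner_on I f s = 0" for f
  proof (rule ccontr)
    assume ne: "inner_on I f f \<noteq> 0"
    have eig: "\<exists>e. mat_app I (A h) s = (\<lambda>i. e * s i)" if "s \<in> U" for s h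
      using v[OF that] by blast
    have "\<exists>u e. (\<forall>i. i \<notin> I \<longrightarrow> u i = 0) \<and> (\<forall>s\<in>U. inner_on I u s = 0) \<and> inner_on I u u = 1 \<and>
      (\<forall>h. mat_app I (A h) u = (\<lambda>i. e h * u i))"
      by (rule common_eigenvector[where f = f]) (rule fin sym comm eig f ne | assumption)+
    then obtain u e where u: "\<And>i. i \<notin> I \<Longrightarrow> u i = 0" "\<And>s. s \<in> U \<Longrightarrow> inner_on I u s = 0" "inner_on I u u = 1"
      "\<And>h. mat_app I (A h) u = (\<lambda>i. e h * u i)"
      by auto
    then have "u \<notin> U" by auto
    moreover have "good (insert u U)"
    proof -
      have "inner_on I u s = 0 \<and> inner_on I s u = 0" if "s \<in> U" for s
        using u(2)[OF that] inner_on_commute[of I s u] by simp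
      moreover have "\<exists>v. \<forall>h. mat_app I (A h) u = (\<lambda>i. v h * u i)" using u(4) by blast
      ultimately show ?thesis
        using U u(1,3) \<open>u \<notin> U\<close> by (simp add: good_def) blast
    qed
    ultimately show False
      using Umax[of "insert u U"] U by (simp add: good_def)
  qed
  have "inner_on I f g = (\<Sum>u\<in>U. inner_on I f u * inner_on I g u)" for f g
  proof -
    let ?r = "\<lambda>i. 1 * f i + (-1) * (\<Sum>u\<in>U. inner_on I f u * u i)"
    \<comment> \<open>Completeness is only available for vectors that vanish outside \<open>I\<close>.\<close>
    let ?r' = "\<lambda>i. if i \<in> I then ?r i else 0"
    have r': "inner_on I ?r' h = inner_on I ?r h" for h
      by (simp add: inner_on_def)
    have "inner_on I ?r' ?r' = 0"
      by (intro complete) (simp, simp only: r' resid[OF U])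
    then have "inner_on I ?r g = 0"
      unfolding inner_on_self_eq_0[OF fin] by (simp add: inner_on_def)
    then show ?thesis unfolding resid2 by simp
  qed
  note parseval = this
  show ?thesis
  proof (rule that[of U v])
    show "finite U" using U by (simp add: good_def)
    show "inner_on I u w = (if u = w then 1 else 0)" if "u \<in> U" "w \<in> U" for u w
      using U that by (simp add: good_def)
  qed (fact v parseval)+
qed

section \<open>Flatness and Gram vectors\<close>

lemma sum_fun_app: "(\<Sum>v\<in>S. F v) \<alpha> = (\<Sum>v\<in>S. (F v :: 'i \<Rightarrow> real) \<alpha>)"
  by (induction S rule: infinite_finite_induct) auto

text \<open>
  Restricting the columns with index in \<open>I0\<close> from the rows \<open>I\<close> to the rows \<open>I0\<close> can only lower their
  rank. Hence a basis \<open>J\<close> of the columns of the small matrix gives as many independent columns of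
  the large matrix as its rank permits, and these span all of its columns.
\<close>

lemma flat_columns:
  fixes A :: "'i \<Rightarrow> 'i \<Rightarrow> real"
  assumes fin: "finite I" and sub: "I0 \<subseteq> I"
    and rank: "mat_rank I A = mat_rank I0 A" and \<beta>: "\<beta> \<in> I"
  shows "\<exists>c. \<forall>\<alpha>\<in>I. A \<alpha> \<beta> = (\<Sum>\<gamma>\<in>I0. c \<gamma> * A \<alpha> \<gamma>)"
proof -
  interpret vs: vector_space "\<lambda>(c::real) (f::'i \<Rightarrow> real) \<alpha>. c * f \<alpha>"
    by (rule vector_space_fun)
  define col where "col K \<gamma> = (\<lambda>\<alpha>. if \<alpha> \<in> K then A \<alpha> \<gamma> else 0)" for K \<gamma>
  have rank_col: "mat_rank K A = vs.dim (col K ` K)" for K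
    by (simp add: mat_rank_def col_def)
  have col_restrict: "col I0 \<gamma> \<alpha> = (if \<alpha> \<in> I0 then col I \<gamma> \<alpha> else 0)" for \<gamma> \<alpha>
    using sub by (auto simp: col_def)
  have fin0: "finite I0" using fin sub finite_subset by blast
  obtain B where B: "B \<subseteq> col I0 ` I0" "vs.independent B" "card B = vs.dim (col I0 ` I0)"
    using vs.basis_exists by metis
  obtain J where J: "J \<subseteq> I0" "inj_on (col I0) J" "B = col I0 ` J"
    using B(1) by (auto simp: subset_image_inj)
  have finJ: "finite J" using J(1) fin0 finite_subset by blast
  have injJ: "inj_on (col I) J"
  proof (rule inj_onI)
    fix \<gamma> \<delta> assume "\<gamma> \<in> J" "\<delta> \<in> J" and eq: "col I \<gamma> = col I \<delta>"
    have "col I0 \<gamma> \<alpha> = col I0 \<delta> \<alpha>" for \<alpha>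
      by (simp add: col_restrict eq)
    with \<open>\<gamma> \<in> J\<close> \<open>\<delta> \<in> J\<close> J(2) show "\<gamma> = \<delta>" by (auto simp: inj_on_def)
  qed
  have indep: "vs.independent (col I ` J)"
  proof
    assume "vs.dependent (col I ` J)"
    then obtain u \<delta> where u: "\<delta> \<in> J" "u (col I \<delta>) \<noteq> 0"
      and "(\<Sum>v\<in>col I ` J. (\<lambda>\<alpha>. u v * v \<alpha>)) = 0"
      by (auto simp: vs.dependent_finite finJ)
    then have zero: "(\<Sum>\<gamma>\<in>J. u (col I \<gamma>) * col I \<gamma> \<alpha>) = 0" for \<alpha>
      by (simp add: sum.reindex[OF injJ] fun_eq_iff sum_fun_app)
    define u' where "u' v = u (col I (the_inv_into J (col I0) v))" for v
    have u': "u' (col I0 \<gamma>) = u (col I \<gamma>)" if "\<gamma> \<in> J" for \<gamma>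
      using that J(2) by (simp add: u'_def the_inv_into_f_f)
    have "(\<Sum>v\<in>B. (\<lambda>\<alpha>. u' v * v \<alpha>)) = 0"
    proof
      fix \<alpha>
      have "(\<Sum>v\<in>B. (\<lambda>\<alpha>. u' v * v \<alpha>)) \<alpha> = (\<Sum>\<gamma>\<in>J. u (col I \<gamma>) * col I0 \<gamma> \<alpha>)"
        by (simp add: J(3) sum.reindex[OF J(2)] sum_fun_app u')
      also have "\<dots> = (if \<alpha> \<in> I0 then \<Sum>\<gamma>\<in>J. u (col I \<gamma>) * col I \<gamma> \<alpha> else 0)"
        using col_restrict[of _ \<alpha>] by (auto intro!: sum.cong sum.neutral)
      finally show "(\<Sum>v\<in>B. (\<lambda>\<alpha>. u' v * v \<alpha>)) \<alpha> = 0 \<alpha>"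
        by (simp add: zero)
    qed
    moreover have "u' (col I0 \<delta>) \<noteq> 0" "col I0 \<delta> \<in> B" using u u' J(3) by auto
    ultimately have "vs.dependent B"
      using vs.dependent_finite[of B] finJ J(3) by blast
    with B(2) show False by simp
  qed
  obtain C where C: "C \<subseteq> col I ` I" "col I ` I \<subseteq> vs.span C" "card C = vs.dim (col I ` I)"
    using vs.basis_exists by metis
  have finC: "finite C" using C(1) fin finite_subset by blast
  have card: "card C = card (col I ` J)"
    using C(3) B(3) J rank card_image[OF injJ] card_image[OF J(2)] by (simp add: rank_col)
  have "col I \<beta> \<in> vs.span (col I ` J)"
  proof (rule ccontr)
    assume n: "col I \<beta> \<notin> vs.span (col I ` J)"
    then have "vs.independent (insert (col I \<beta>) (col I ` J))"
      using indep by (rule vs.independent_insertI)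
    moreover have "insert (col I \<beta>) (col I ` J) \<subseteq> vs.span C"
      using C(2) \<beta> J(1) sub by auto
    ultimately have "card (insert (col I \<beta>) (col I ` J)) \<le> card C"
      using vs.independent_span_bound[OF finC] by blast
    moreover have "col I \<beta> \<notin> col I ` J" using n vs.span_base by blast
    ultimately show False using card finJ by simp
  qed
  then obtain u where u: "col I \<beta> = (\<Sum>v\<in>col I ` J. (\<lambda>\<alpha>. u v * v \<alpha>))"
    using finJ by (auto simp: vs.span_finite)
  have "A \<alpha> \<beta> = (\<Sum>\<gamma>\<in>I0. (if \<gamma> \<in> J then u (col I \<gamma>) else 0) * A \<alpha> \<gamma>)" if "\<alpha> \<in> I" for \<alpha>
  proof -
    have "A \<alpha> \<beta> = (\<Sum>\<gamma>\<in>J. u (col I \<gamma>) * A \<alpha> \<gamma>)"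
      using fun_cong[OF u, of \<alpha>] that
      by (simp add: sum.reindex[OF injJ] sum_fun_app) (simp add: col_def)
    also have "\<dots> = (\<Sum>\<gamma>\<in>I0. (if \<gamma> \<in> J then u (col I \<gamma>) else 0) * A \<alpha> \<gamma>)"
      using J(1) fin0 by (intro sum.mono_neutral_cong_left) auto
    finally show ?thesis .
  qed
  then show ?thesis
    by (intro exI[of _ "\<lambda>\<gamma>. if \<gamma> \<in> J then u (col I \<gamma>) else 0"]) blast
qed

lemma mat_psd_subset:
  assumes "mat_psd I A" "I0 \<subseteq> I" "finite I"
  shows "mat_psd I0 A"
proof -
  have "(\<Sum>\<alpha>\<in>I0. \<Sum>\<beta>\<in>I0. u \<alpha> * A \<alpha> \<beta> * u \<beta>) \<ge> 0" for u
  proof -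
    let ?u = "\<lambda>\<alpha>. if \<alpha> \<in> I0 then u \<alpha> else 0"
    have "0 \<le> (\<Sum>\<alpha>\<in>I. \<Sum>\<beta>\<in>I. ?u \<alpha> * A \<alpha> \<beta> * ?u \<beta>)"
      using assms(1) by (simp only: mat_psd_def)
    also have "\<dots> = (\<Sum>\<alpha>\<in>I0. \<Sum>\<beta>\<in>I. ?u \<alpha> * A \<alpha> \<beta> * ?u \<beta>)"
      using assms by (intro sum.mono_neutral_right) auto
    also have "\<dots> = (\<Sum>\<alpha>\<in>I0. \<Sum>\<beta>\<in>I0. ?u \<alpha> * A \<alpha> \<beta> * ?u \<beta>)"
      using assms by (intro sum.cong refl sum.mono_neutral_right) auto
    also have "\<dots> = (\<Sum>\<alpha>\<in>I0. \<Sum>\<beta>\<in>I0. u \<alpha> * A \<alpha> \<beta> * u \<beta>)"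
      by (intro sum.cong) auto
    finally show ?thesis .
  qed
  moreover have "\<forall>\<alpha>\<in>I0. \<forall>\<beta>\<in>I0. A \<alpha> \<beta> = A \<beta> \<alpha>"
    using assms(1,2) unfolding mat_psd_def by blast
  ultimately show ?thesis by (simp add: mat_psd_def)
qed

text \<open>
  The spectral theorem for the block \<open>M\<close> on \<open>I0\<close> provides the Gram vectors: with eigenvectors \<open>u\<close>
  of eigenvalue \<open>\<mu> u > 0\<close> as coordinates, \<open>w \<alpha> u = sqrt (\<mu> u) * u \<alpha>\<close>. They extend to \<open>I\<close> by the
  linear relations between columns that flatness supplies. The rows of \<open>G\<close> express the unit
  coordinate vectors as combinations of the vectors \<open>w \<gamma>\<close> with \<open>\<gamma> \<in> I0\<close>, which is the form in
  which the spanning property is used.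
\<close>

lemma flat_psd_gram:
  fixes M :: "'i \<Rightarrow> 'i \<Rightarrow> real"
  assumes fin: "finite I" and sub: "I0 \<subseteq> I" and psd: "mat_psd I M"
    and flat: "mat_rank I M = mat_rank I0 M"
  obtains J :: "('i \<Rightarrow> real) set" and G :: "('i \<Rightarrow> real) \<Rightarrow> 'i \<Rightarrow> real"
    and w :: "'i \<Rightarrow> ('i \<Rightarrow> real) \<Rightarrow> real"
  where "finite J"
    "\<And>\<alpha> \<beta>. \<alpha> \<in> I \<Longrightarrow> \<beta> \<in> I \<Longrightarrow> M \<alpha> \<beta> = inner_on J (w \<alpha>) (w \<beta>)"
    "\<And>u \<alpha>. u \<in> J \<Longrightarrow> \<alpha> \<in> I \<Longrightarrow> w \<alpha> u = (\<Sum>\<gamma>\<in>I0. G u \<gamma> * M \<gamma> \<alpha>)"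
    "\<And>u u'. u \<in> J \<Longrightarrow> u' \<in> J \<Longrightarrow> (\<Sum>\<gamma>\<in>I0. G u \<gamma> * w \<gamma> u') = (if u = u' then 1 else 0)"
proof -
  have fin0: "finite I0" using fin sub finite_subset by blast
  have psd0: "mat_psd I0 M" using mat_psd_subset[OF psd sub fin] .
  have sym: "M \<alpha> \<beta> = M \<beta> \<alpha>" if "\<alpha> \<in> I" "\<beta> \<in> I" for \<alpha> \<beta>
    using psd that by (auto simp: mat_psd_def)
  have msym: "mat_sym I0 M" using psd0 by (auto simp: mat_psd_def mat_sym_def)
  obtain U :: "('i \<Rightarrow> real) set" and v :: "('i \<Rightarrow> real) \<Rightarrow> unit \<Rightarrow> real" where U: "finite U"
    "\<And>u w. u \<in> U \<Longrightarrow> w \<in> U \<Longrightarrow> inner_on I0 u w = (if u = w then 1 else 0)"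
    "\<And>u h. u \<in> U \<Longrightarrow> mat_app I0 M u = (\<lambda>i. v u h * u i)"
    "\<And>f g. inner_on I0 f g = (\<Sum>u\<in>U. inner_on I0 f u * inner_on I0 g u)"
    using simultaneous_diagonalization[where A = "\<lambda>_::unit. M", OF fin0 msym]
    unfolding mat_comm_def by blast
  define \<mu> where "\<mu> u = v u ()" for u
  have eig: "(\<Sum>\<gamma>\<in>I0. M \<alpha> \<gamma> * u \<gamma>) = \<mu> u * u \<alpha>" if "u \<in> U" "\<alpha> \<in> I0" for u \<alpha>
    using fun_cong[OF U(3)[OF that(1), of "()"], of \<alpha>] that(2) by (simp add: mat_app_def \<mu>_def)
  have \<mu>_nonneg: "\<mu> u \<ge> 0" if "u \<in> U" for u
  proof -
    have "0 \<le> (\<Sum>\<alpha>\<in>I0. \<Sum>\<beta>\<in>I0. u \<alpha> * M \<alpha> \<beta> * u \<beta>)"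
      using psd0 by (simp add: mat_psd_def)
    also have "\<dots> = (\<Sum>\<alpha>\<in>I0. u \<alpha> * (\<mu> u * u \<alpha>))"
      using that by (simp add: eig[symmetric] sum_distrib_left mult.assoc)
    also have "\<dots> = \<mu> u * inner_on I0 u u"
      by (simp add: inner_on_def sum_distrib_left mult_ac)
    also have "\<dots> = \<mu> u" using that by (simp add: U(2))
    finally show ?thesis .
  qed
  \<comment> \<open>Kernel vectors contribute nothing to \<open>M\<close> and must be left out, because \<open>G\<close> divides by
    the square root of the eigenvalue.\<close>
  define J where "J = {u \<in> U. \<mu> u > 0}"
  define G where "G u \<gamma> = u \<gamma> / sqrt (\<mu> u)" for u \<gamma>
  define w where "w \<alpha> u = (\<Sum>\<gamma>\<in>I0. G u \<gamma> * M \<gamma> \<alpha>)" for \<alpha> u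
  have w0: "w \<alpha> u = sqrt (\<mu> u) * u \<alpha>" if "u \<in> J" "\<alpha> \<in> I0" for u \<alpha>
  proof -
    have "w \<alpha> u = (\<Sum>\<gamma>\<in>I0. M \<alpha> \<gamma> * u \<gamma>) / sqrt (\<mu> u)"
      unfolding w_def G_def sum_divide_distrib
      using sym sub that(2) by (intro sum.cong) (auto simp: subset_iff)
    also have "\<dots> = \<mu> u / sqrt (\<mu> u) * u \<alpha>" using that by (simp add: eig J_def)
    also have "\<mu> u / sqrt (\<mu> u) = sqrt (\<mu> u)" using that by (simp add: J_def real_div_sqrt)
    finally show ?thesis .
  qed
  have dual: "(\<Sum>\<gamma>\<in>I0. G u \<gamma> * w \<gamma> u') = (if u = u' then 1 else 0)" if "u \<in> J" "u' \<in> J" for u u'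
  proof -
    have "(\<Sum>\<gamma>\<in>I0. G u \<gamma> * w \<gamma> u') = sqrt (\<mu> u') / sqrt (\<mu> u) * inner_on I0 u u'"
      unfolding inner_on_def sum_distrib_left using that by (intro sum.cong) (auto simp: w0 G_def)
    then show ?thesis using that by (auto simp: U(2) J_def)
  qed
  have gram0: "M \<alpha> \<beta> = inner_on J (w \<alpha>) (w \<beta>)" if "\<alpha> \<in> I0" "\<beta> \<in> I0" for \<alpha> \<beta>
  proof -
    let ?d = "\<lambda>\<gamma>. if \<gamma> = \<beta> then 1 else 0 :: real"
    have d: "inner_on I0 f ?d = f \<beta>" for f
      using fin0 that by (simp add: inner_on_def if_distrib cong: if_cong)
    have "M \<alpha> \<beta> = (\<Sum>u\<in>U. inner_on I0 (M \<alpha>) u * inner_on I0 ?d u)"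
      using U(4)[of "M \<alpha>" ?d] by (simp add: d)
    also have "\<dots> = (\<Sum>u\<in>U. \<mu> u * u \<alpha> * u \<beta>)"
      using eig that by (intro sum.cong refl) (simp add: inner_on_commute[of I0 ?d] d inner_on_def[of I0 "M \<alpha>"])
    also have "\<dots> = (\<Sum>u\<in>J. \<mu> u * u \<alpha> * u \<beta>)"
      using U(1) \<mu>_nonneg by (intro sum.mono_neutral_right) (auto simp: J_def order_less_le)
    also have "\<dots> = inner_on J (w \<alpha>) (w \<beta>)"
    proof -
      have "\<mu> u * u \<alpha> * u \<beta> = w \<alpha> u * w \<beta> u" if "u \<in> J" for u
      proof -
        have "\<mu> u = sqrt (\<mu> u) * sqrt (\<mu> u)" using that by (simp add: J_def)
        then show ?thesis
          unfolding w0[OF that \<open>\<alpha> \<in> I0\<close>] w0[OF that \<open>\<beta> \<in> I0\<close>] by (metis mult.assoc mult.left_commute)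
      qed
      then show ?thesis by (simp add: inner_on_def)
    qed
    finally show ?thesis .
  qed
  obtain c where c: "\<And>\<alpha> \<beta>. \<alpha> \<in> I \<Longrightarrow> \<beta> \<in> I \<Longrightarrow> M \<alpha> \<beta> = (\<Sum>\<gamma>\<in>I0. c \<beta> \<gamma> * M \<alpha> \<gamma>)"
    using flat_columns[OF fin sub flat] by metis
  have w_lin: "w \<beta> u = (\<Sum>\<gamma>\<in>I0. c \<beta> \<gamma> * w \<gamma> u)" if "\<beta> \<in> I" for \<beta> u
  proof -
    have "w \<beta> u = (\<Sum>\<delta>\<in>I0. \<Sum>\<gamma>\<in>I0. G u \<delta> * (c \<beta> \<gamma> * M \<delta> \<gamma>))"
      unfolding w_def using that sub c by (intro sum.cong refl) (simp add: sum_distrib_left subset_iff)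
    also have "\<dots> = (\<Sum>\<gamma>\<in>I0. c \<beta> \<gamma> * w \<gamma> u)"
      unfolding w_def sum_distrib_left by (subst sum.swap) (simp add: mult.left_commute)
    finally show ?thesis .
  qed
  have inner_gram: "inner_on J x (w \<beta>) = (\<Sum>\<gamma>\<in>I0. c \<beta> \<gamma> * inner_on J x (w \<gamma>))" if "\<beta> \<in> I" for x \<beta>
    unfolding w_lin[OF that] by (rule inner_on_sum_right)
  have gram1: "M \<alpha> \<beta> = inner_on J (w \<alpha>) (w \<beta>)" if "\<alpha> \<in> I0" "\<beta> \<in> I" for \<alpha> \<beta>
  proof -
    have "\<alpha> \<in> I" using that(1) sub by blast
    from c[OF this that(2)] show ?thesis
      unfolding inner_gram[OF that(2)] using that(1) gram0 by simp
  qed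
  have gram: "M \<alpha> \<beta> = inner_on J (w \<alpha>) (w \<beta>)" if "\<alpha> \<in> I" "\<beta> \<in> I" for \<alpha> \<beta>
  proof -
    have "M \<alpha> \<beta> = (\<Sum>\<gamma>\<in>I0. c \<beta> \<gamma> * M \<gamma> \<alpha>)"
      using that sub sym unfolding c[OF that] by (intro sum.cong) auto
    then show ?thesis
      unfolding inner_gram[OF that(2)] using that(1) gram1 by (simp add: inner_on_commute[of J "w \<alpha>"])
  qed
  show ?thesis
  proof (rule that[of J w G])
    show "finite J" using U(1) by (simp add: J_def)
    show "w \<alpha> u = (\<Sum>\<gamma>\<in>I0. G u \<gamma> * M \<gamma> \<alpha>)" for u \<alpha> by (simp add: w_def)
  qed (fact gram dual)+
qed

section \<open>Exponents and moment functionals\<close>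

lemma expo_deg_zero [simp]: "expo_deg 0 = 0"
  by (simp add: expo_deg_def)

lemma expo_deg_add: "expo_deg (\<alpha> + \<beta>) = expo_deg \<alpha> + expo_deg \<beta>"
  by (simp add: expo_deg_def lookup_add sum.distrib)

lemma expo_deg_unit [simp]: "expo_deg (unit_expo i) = 1"
  by (simp add: expo_deg_def unit_expo_def lookup_single when_def)

lemma mono_eval_zero [simp]: "mono_eval x 0 = 1"
  by (simp add: mono_eval_def)

lemma mono_eval_add: "mono_eval x (\<alpha> + \<beta>) = mono_eval x \<alpha> * mono_eval x \<beta>"
  by (simp add: mono_eval_def lookup_add power_add prod.distrib)

lemma mono_eval_unit [simp]: "mono_eval x (unit_expo i) = x $ i"
proof -
  have "mono_eval x (unit_expo i) = (\<Prod>j\<in>UNIV. if j = i then x $ i else 1)"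
    unfolding mono_eval_def unit_expo_def
    by (intro prod.cong) (auto simp: lookup_single when_def)
  then show ?thesis by simp
qed

lemma finite_expos_upto [simp]: "finite (expos_upto k :: 'n::finite expo set)"
proof (rule finite_imageD)
  have "Poly_Mapping.lookup ` expos_upto k \<subseteq> PiE UNIV (\<lambda>_::'n. {..k})"
  proof clarify
    fix \<alpha> :: "'n expo" assume "\<alpha> \<in> expos_upto k"
    then have "Poly_Mapping.lookup \<alpha> i \<le> k" for i
      using member_le_sum[of i UNIV "Poly_Mapping.lookup \<alpha>"] by (simp add: expos_upto_def expo_deg_def)
    then show "Poly_Mapping.lookup \<alpha> \<in> PiE UNIV (\<lambda>_. {..k})" by auto
  qed
  then show "finite (Poly_Mapping.lookup ` (expos_upto k :: 'n expo set))"
    by (rule finite_subset) (intro finite_PiE, auto)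
qed (simp add: inj_on_def lookup_inject)

lemma expos_upto_mono: "s \<le> t \<Longrightarrow> expos_upto s \<subseteq> expos_upto t"
  by (auto simp: expos_upto_def)

lemma expo_induct [case_names zero unit]:
  assumes "P 0" and step: "\<And>i \<delta>. P \<delta> \<Longrightarrow> P (unit_expo i + \<delta>)"
  shows "P (\<gamma> :: 'n::finite expo)"
proof (induction "expo_deg \<gamma>" arbitrary: \<gamma>)
  case 0
  then have "Poly_Mapping.lookup \<gamma> i = 0" for i by (simp add: expo_deg_def)
  then have "\<gamma> = 0" by (intro poly_mapping_eqI) simp
  with assms(1) show ?case by simp
next
  case (Suc n)
  then have "\<exists>i. Poly_Mapping.lookup \<gamma> i \<noteq> 0"
    by (metis expo_deg_def nat.distinct(1) sum.neutral)
  then obtain i where i: "Poly_Mapping.lookup \<gamma> i \<noteq> 0" by blast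
  have eq: "\<gamma> = unit_expo i + (\<gamma> - unit_expo i)"
    using i by (intro poly_mapping_eqI) (auto simp: lookup_add lookup_minus unit_expo_def lookup_single when_def)
  then have "expo_deg \<gamma> = 1 + expo_deg (\<gamma> - unit_expo i)"
    by (metis expo_deg_add expo_deg_unit)
  then have "P (\<gamma> - unit_expo i)" using Suc by simp
  then show ?case by (subst eq) (rule step)
qed

text \<open>
  This transfers a factorization of the entries of the moment matrix of order \<open>t\<close> to all moments
  of degree up to \<open>2 * t\<close>.
\<close>

lemma expo_split:
  "expo_deg (\<gamma> :: 'n::finite expo) \<le> s + t \<Longrightarrow>
    \<exists>\<alpha> \<beta>. \<gamma> = \<alpha> + \<beta> \<and> expo_deg \<alpha> \<le> s \<and> expo_deg \<beta> \<le> t"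
proof (induction \<gamma> arbitrary: s rule: expo_induct)
  case (unit i \<delta>)
  show ?case
  proof (cases s)
    case 0
    with unit.prems show ?thesis by (intro exI[of _ 0] exI[of _ "unit_expo i + \<delta>"]) simp
  next
    case (Suc s')
    with unit obtain \<alpha> \<beta> where "\<delta> = \<alpha> + \<beta>" "expo_deg \<alpha> \<le> s'" "expo_deg \<beta> \<le> t"
      by (force simp: expo_deg_add)
    with Suc show ?thesis
      by (intro exI[of _ "unit_expo i + \<alpha>"] exI[of _ \<beta>]) (simp add: expo_deg_add add.assoc)
  qed
qed (auto intro: exI[of _ 0])

lemma riesz_superset:
  "finite S \<Longrightarrow> Poly_Mapping.keys q \<subseteq> S \<Longrightarrow> riesz q y = (\<Sum>\<alpha>\<in>S. Poly_Mapping.lookup q \<alpha> * y \<alpha>)"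
  unfolding riesz_def by (intro sum.mono_neutral_left) (auto simp: in_keys_iff)

lemma riesz_add: "riesz (q + r) y = riesz q y + riesz r y"
proof -
  let ?S = "Poly_Mapping.keys q \<union> Poly_Mapping.keys r"
  have "riesz (q + r) y = (\<Sum>\<alpha>\<in>?S. Poly_Mapping.lookup (q + r) \<alpha> * y \<alpha>)"
    using keys_add[of q r] by (intro riesz_superset) auto
  moreover have "riesz q y = (\<Sum>\<alpha>\<in>?S. Poly_Mapping.lookup q \<alpha> * y \<alpha>)" "riesz r y = (\<Sum>\<alpha>\<in>?S. Poly_Mapping.lookup r \<alpha> * y \<alpha>)"
    by (auto intro: riesz_superset)
  ultimately show ?thesis
    by (simp add: lookup_add sum.distrib algebra_simps)
qed

lemma riesz_single [simp]: "riesz (Poly_Mapping.single \<alpha> a) y = a * y \<alpha>"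
  by (simp add: riesz_def)

lemma riesz_zero [simp]: "riesz 0 y = 0"
  by (simp add: riesz_def)

lemma riesz_mult_single:
  "riesz (q * Poly_Mapping.single \<delta> 1) y = riesz q (\<lambda>\<gamma>. y (\<gamma> + \<delta>))"
proof (induction q rule: update_induct)
  case (update f a b)
  then have "Poly_Mapping.update a b f = f + Poly_Mapping.single a b"
    by (intro poly_mapping_eqI)
       (auto simp: lookup_update lookup_add lookup_single when_def in_keys_iff)
  with update.IH show ?case
    by (simp add: riesz_add distrib_right mult_single)
qed simp

lemma loc_mat_eq: "loc_mat q y \<alpha> \<beta> = riesz q (\<lambda>\<gamma>. y (\<gamma> + \<alpha> + \<beta>))"
  by (simp add: loc_mat_def riesz_mult_single)

text \<open>
  Moment matrices need no separate treatment below: they localize at the constant 1.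
\<close>

lemma moment_mat_eq_loc_mat: "moment_mat y = loc_mat 1 y"
  by (intro ext) (simp add: moment_mat_def loc_mat_eq flip: single_one)

lemma poly_eval_one [simp]: "poly_eval 1 x = 1"
  by (simp add: poly_eval_def flip: single_one)

lemma poly_deg_one [simp]: "poly_deg 1 = 0"
  by (simp add: poly_deg_def flip: single_one)

lemma expo_deg_le_poly_deg: "\<alpha> \<in> Poly_Mapping.keys q \<Longrightarrow> expo_deg \<alpha> \<le> poly_deg q"
  by (simp add: poly_deg_def)

lemma poly_deg_le_half_deg: "poly_deg q \<le> 2 * half_deg q"
  unfolding half_deg_def by linarith

lemma riesz_atoms:
  assumes "\<And>\<gamma>. \<gamma> \<in> Poly_Mapping.keys q \<Longrightarrow> y \<gamma> = (\<Sum>u\<in>Q. l u * mono_eval (v u) \<gamma>)"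
  shows "riesz q y = (\<Sum>u\<in>Q. l u * poly_eval q (v u))"
proof -
  have "riesz q y = (\<Sum>\<gamma>\<in>Poly_Mapping.keys q. \<Sum>u\<in>Q. l u * (Poly_Mapping.lookup q \<gamma> * mono_eval (v u) \<gamma>))"
    unfolding riesz_def by (intro sum.cong refl) (simp add: assms sum_distrib_left mult_ac)
  also have "\<dots> = (\<Sum>u\<in>Q. l u * poly_eval q (v u))"
    unfolding poly_eval_def sum_distrib_left by (rule sum.swap)
  finally show ?thesis .
qed

lemma loc_mat_atoms:
  assumes y: "\<And>\<gamma>. expo_deg \<gamma> \<le> D \<Longrightarrow> y \<gamma> = (\<Sum>u\<in>Q. l u * mono_eval (v u) \<gamma>)"
    and D: "poly_deg q + expo_deg \<alpha> + expo_deg \<beta> \<le> D"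
  shows "loc_mat q y \<alpha> \<beta>
    = (\<Sum>u\<in>Q. l u * mono_eval (v u) \<alpha> * mono_eval (v u) \<beta> * poly_eval q (v u))"
  unfolding loc_mat_eq
proof (rule riesz_atoms)
  fix \<gamma> assume "\<gamma> \<in> Poly_Mapping.keys q"
  then have "expo_deg (\<gamma> + \<alpha> + \<beta>) \<le> D"
    using D expo_deg_le_poly_deg[of \<gamma> q] by (simp add: expo_deg_add)
  from y[OF this] show "y (\<gamma> + \<alpha> + \<beta>) =
      (\<Sum>u\<in>Q. l u * mono_eval (v u) \<alpha> * mono_eval (v u) \<beta> * mono_eval (v u) \<gamma>)"
    by (simp add: mono_eval_add mult_ac)
qed

text \<open>
  The quadratic form of the localizing matrix at the coefficient vector of a polynomial \<open>g\<close> is the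
  functional \<open>y\<close> at \<open>q * g\<^sup>2\<close>, which for a combination of point evaluations is the corresponding
  combination of values.
\<close>

lemma loc_mat_form_atoms:
  assumes y: "\<And>\<gamma>. expo_deg \<gamma> \<le> D \<Longrightarrow> y \<gamma> = (\<Sum>u\<in>Q. l u * mono_eval (v u) \<gamma>)"
    and D: "poly_deg q + 2 * s \<le> D"
  shows "(\<Sum>\<alpha>\<in>expos_upto s. \<Sum>\<beta>\<in>expos_upto s. g \<alpha> * loc_mat q y \<alpha> \<beta> * g \<beta>)
    = (\<Sum>u\<in>Q. l u * poly_eval q (v u) * (\<Sum>\<alpha>\<in>expos_upto s. g \<alpha> * mono_eval (v u) \<alpha>)\<^sup>2)"
proof -
  let ?S = "expos_upto s"
  have loc: "loc_mat q y \<alpha> \<beta> = (\<Sum>u\<in>Q. l u * mono_eval (v u) \<alpha> * mono_eval (v u) \<beta> * poly_eval q (v u))"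
    if "\<alpha> \<in> ?S" "\<beta> \<in> ?S" for \<alpha> \<beta>
    using that D by (intro loc_mat_atoms[OF y]) (auto simp: expos_upto_def)
  have "(\<Sum>\<alpha>\<in>?S. \<Sum>\<beta>\<in>?S. g \<alpha> * loc_mat q y \<alpha> \<beta> * g \<beta>) =
    (\<Sum>\<alpha>\<in>?S. \<Sum>\<beta>\<in>?S. \<Sum>u\<in>Q. l u * poly_eval q (v u) * ((g \<alpha> * mono_eval (v u) \<alpha>) * (g \<beta> * mono_eval (v u) \<beta>)))"
    by (intro sum.cong refl) (simp add: loc sum_distrib_left sum_distrib_right mult_ac)
  also have "\<dots> = (\<Sum>\<alpha>\<in>?S. \<Sum>u\<in>Q. \<Sum>\<beta>\<in>?S. l u * poly_eval q (v u) * ((g \<alpha> * mono_eval (v u) \<alpha>) * (g \<beta> * mono_eval (v u) \<beta>)))"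
    by (intro sum.cong refl) (rule sum.swap)
  also have "\<dots> = (\<Sum>u\<in>Q. \<Sum>\<alpha>\<in>?S. \<Sum>\<beta>\<in>?S. l u * poly_eval q (v u) * ((g \<alpha> * mono_eval (v u) \<alpha>) * (g \<beta> * mono_eval (v u) \<beta>)))"
    by (rule sum.swap)
  also have "\<dots> = (\<Sum>u\<in>Q. l u * poly_eval q (v u) * (\<Sum>\<alpha>\<in>?S. g \<alpha> * mono_eval (v u) \<alpha>)\<^sup>2)"
    by (simp add: power2_eq_square sum_product flip: sum_distrib_left)
  finally show ?thesis .
qed

section \<open>Atoms of a flat moment sequence\<close>

text \<open>
  The index \<open>q\<close> is a common eigenvector of the multiplication operators. The polynomial with
  coefficients \<open>g q\<close> represents it in the span of the Gram vectors, so orthonormality of the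
  eigenvectors turns into interpolation: the last property says that this polynomial vanishes at
  every atom \<open>v r\<close> with \<open>r \<noteq> q\<close> but not at \<open>v q\<close>, and that no atom has weight 0. Its degree is at
  most \<open>t - d\<close>, which leaves room for multiplying its square by a constraint of degree at most
  \<open>2 * d\<close>.
\<close>

theorem flat_moment_atoms:
  fixes y :: "'n::finite expo \<Rightarrow> real"
  assumes d: "1 \<le> d" "d \<le> t"
    and psd: "mat_psd (expos_upto t) (moment_mat y)"
    and flat: "mat_rank (expos_upto t) (moment_mat y) = mat_rank (expos_upto (t - d)) (moment_mat y)"
  obtains Q :: "(('n expo \<Rightarrow> real) \<Rightarrow> real) set" and l and v :: "_ \<Rightarrow> real ^ 'n"
    and g :: "_ \<Rightarrow> 'n expo \<Rightarrow> real"
  where "finite Q" "\<And>q. q \<in> Q \<Longrightarrow> 0 \<le> l q"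
    "\<And>\<gamma>. expo_deg \<gamma> \<le> 2 * t \<Longrightarrow> y \<gamma> = (\<Sum>q\<in>Q. l q * mono_eval (v q) \<gamma>)"
    "\<And>q r. q \<in> Q \<Longrightarrow> r \<in> Q \<Longrightarrow>
      l r * (\<Sum>\<alpha>\<in>expos_upto (t - d). g q \<alpha> * mono_eval (v r) \<alpha>)\<^sup>2 = (if q = r then 1 else 0)"
proof -
  define I where "I = (expos_upto t :: 'n expo set)"
  define I0 where "I0 = (expos_upto (t - d) :: 'n expo set)"
  have fin: "finite I" "finite I0" and sub: "I0 \<subseteq> I"
    by (simp_all add: I_def I0_def expos_upto_mono)
  obtain J :: "('n expo \<Rightarrow> real) set" and G w where finJ: "finite J"
    and gram: "\<And>\<alpha> \<beta>. \<alpha> \<in> I \<Longrightarrow> \<beta> \<in> I \<Longrightarrow> y (\<alpha> + \<beta>) = inner_on J (w \<alpha>) (w \<beta>)"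
    and w: "\<And>u \<alpha>. u \<in> J \<Longrightarrow> \<alpha> \<in> I \<Longrightarrow> w \<alpha> u = (\<Sum>\<gamma>\<in>I0. G u \<gamma> * y (\<gamma> + \<alpha>))"
    and dual: "\<And>u u'. u \<in> J \<Longrightarrow> u' \<in> J \<Longrightarrow> (\<Sum>\<gamma>\<in>I0. G u \<gamma> * w \<gamma> u') = (if u = u' then 1 else 0)"
    by (rule flat_psd_gram[OF fin(1) sub psd[folded I_def] flat[folded I_def I0_def]])
       (unfold moment_mat_def, rule that)
  have shift_in: "\<beta> + unit_expo i \<in> I" if "\<beta> \<in> expos_upto (t - 1)" for \<beta> i
    using that d by (simp add: I_def expos_upto_def expo_deg_add)
  have I0_sub: "I0 \<subseteq> expos_upto (t - 1)"
    unfolding I0_def using d by (intro expos_upto_mono) simp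
  have shift_in0: "\<beta> + unit_expo i \<in> I" if "\<beta> \<in> I0" for \<beta> i
    using that I0_sub shift_in by blast
  \<comment> \<open>\<open>A i\<close> is the matrix of multiplication by the \<open>i\<close>-th variable: the row \<open>u\<close> is the image of the \<open>u\<close>-th
    coordinate vector, written as a combination of the \<open>w \<gamma>\<close> and shifted by \<open>unit_expo i\<close>. The
    shift stays inside degree \<open>t\<close> because \<open>d \<ge> 1\<close>.\<close>
  define A where "A i u u' = (\<Sum>\<gamma>\<in>I0. G u \<gamma> * w (\<gamma> + unit_expo i) u')" for i u u'
  have sym: "mat_sym J (A i)" for i
  proof -
    have A_eq: "A i u u' = (\<Sum>\<gamma>\<in>I0. \<Sum>\<delta>\<in>I0. G u \<gamma> * G u' \<delta> * y (\<gamma> + \<delta> + unit_expo i))"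
      if "u' \<in> J" for u u'
      unfolding A_def by (intro sum.cong refl) (simp add: w[OF that shift_in0] sum_distrib_left add_ac mult_ac)
    have "A i u u' = A i u' u" if "u \<in> J" "u' \<in> J" for u u'
      unfolding A_eq[OF that(1)] A_eq[OF that(2)]
      by (subst sum.swap) (intro sum.cong refl, simp add: add_ac mult_ac)
    then show ?thesis by (simp add: mat_sym_def)
  qed
  have comm: "mat_comm J (A i) (A h)" for i h
  proof -
    have *: "(\<Sum>k\<in>J. A i u k * A h k u') =
        (\<Sum>\<gamma>\<in>I0. \<Sum>\<delta>\<in>I0. G u \<gamma> * (G u' \<delta> * y (\<gamma> + \<delta> + unit_expo i + unit_expo h)))"
      if "u \<in> J" "u' \<in> J" for u u' i h
    proof -
      have "(\<Sum>k\<in>J. A i u k * A h k u') = (\<Sum>k\<in>J. A i u k * A h u' k)"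
        using sym[of h] that by (intro sum.cong) (auto simp: mat_sym_def)
      also have "\<dots> = inner_on J (\<lambda>k. A i u k) (\<lambda>k. A h u' k)" by (simp add: inner_on_def)
      also have "\<dots> = (\<Sum>\<gamma>\<in>I0. G u \<gamma> * (\<Sum>\<delta>\<in>I0. G u' \<delta> *
          inner_on J (w (\<gamma> + unit_expo i)) (w (\<delta> + unit_expo h))))"
        unfolding A_def inner_on_sum_left inner_on_sum_right ..
      also have "\<dots> = (\<Sum>\<gamma>\<in>I0. G u \<gamma> * (\<Sum>\<delta>\<in>I0. G u' \<delta> *
          y (\<gamma> + \<delta> + unit_expo i + unit_expo h)))"
        by (intro sum.cong refl arg_cong2[of _ _ _ _ "(*)"])
           (simp add: gram[symmetric] shift_in0 add_ac)
      finally show ?thesis by (simp add: sum_distrib_left)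
    qed
    show ?thesis
      unfolding mat_comm_def by (simp add: * add_ac)
  qed
  \<comment> \<open>Although \<open>A i\<close> was built from degrees up to \<open>t - d\<close> only, it shifts all \<open>w \<beta>\<close> of degree
    below \<open>t\<close>.\<close>
  have shift: "mat_app J (A i) (w \<beta>) u = w (\<beta> + unit_expo i) u"
    if "\<beta> \<in> expos_upto (t - 1)" "u \<in> J" for i \<beta> u
  proof -
    have "\<beta> \<in> I" using that expos_upto_mono[of "t - 1" t] by (auto simp: I_def)
    have "mat_app J (A i) (w \<beta>) u = inner_on J (\<lambda>k. A i u k) (w \<beta>)"
      using that by (simp add: mat_app_def inner_on_def)
    also have "\<dots> = (\<Sum>\<gamma>\<in>I0. G u \<gamma> * inner_on J (w (\<gamma> + unit_expo i)) (w \<beta>))"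
      unfolding A_def inner_on_sum_left ..
    also have "\<dots> = (\<Sum>\<gamma>\<in>I0. G u \<gamma> * y (\<gamma> + (\<beta> + unit_expo i)))"
      using \<open>\<beta> \<in> I\<close> by (intro sum.cong refl) (simp add: gram[symmetric] shift_in0 add_ac)
    also have "\<dots> = w (\<beta> + unit_expo i) u"
      using w[OF that(2) shift_in[OF that(1)]] by simp
    finally show ?thesis .
  qed
  obtain Q :: "(('n expo \<Rightarrow> real) \<Rightarrow> real) set" and e :: "_ \<Rightarrow> 'n \<Rightarrow> real" where Q: "finite Q"
    "\<And>q r. q \<in> Q \<Longrightarrow> r \<in> Q \<Longrightarrow> inner_on J q r = (if q = r then 1 else 0)"
    "\<And>q i. q \<in> Q \<Longrightarrow> mat_app J (A i) q = (\<lambda>u. e q i * q u)"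
    "\<And>f g. inner_on J f g = (\<Sum>q\<in>Q. inner_on J f q * inner_on J g q)"
    by (rule simultaneous_diagonalization[where A = A, OF finJ sym comm]) (rule that)
  define v where "v q = (\<chi> i. e q i)" for q
  define s where "s q = inner_on J (w 0) q" for q
  define g where "g q \<gamma> = (\<Sum>u\<in>J. q u * G u \<gamma>)" for q \<gamma>
  have inner_gram: "expo_deg \<alpha> \<le> t \<Longrightarrow> inner_on J (w \<alpha>) q = mono_eval (v q) \<alpha> * s q" if q: "q \<in> Q" for q \<alpha>
  proof (induction \<alpha> rule: expo_induct)
    case zero
    then show ?case by (simp add: s_def)
  next
    case (unit i \<delta>)
    then have \<delta>: "\<delta> \<in> expos_upto (t - 1)" "expo_deg \<delta> \<le> t"
      by (simp_all add: expos_upto_def expo_deg_add)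
    have "inner_on J (w (unit_expo i + \<delta>)) q = inner_on J (mat_app J (A i) (w \<delta>)) q"
      using shift[OF \<delta>(1)] by (intro inner_on_cong) (simp_all add: add.commute)
    also have "\<dots> = inner_on J (w \<delta>) (mat_app J (A i) q)" by (rule inner_on_mat_app_sym[OF sym])
    also have "\<dots> = e q i * inner_on J (w \<delta>) q"
      unfolding Q(3)[OF q] by (simp add: inner_on_def sum_distrib_left mult_ac)
    also have "\<dots> = mono_eval (v q) (unit_expo i + \<delta>) * s q"
      using unit.IH[OF \<delta>(2)] by (simp add: mono_eval_add v_def)
    finally show ?case .
  qed
  have rep: "y \<gamma> = (\<Sum>q\<in>Q. (s q)\<^sup>2 * mono_eval (v q) \<gamma>)" if \<gamma>: "expo_deg \<gamma> \<le> 2 * t" for \<gamma>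
  proof -
    obtain \<alpha> \<beta> where ab: "\<gamma> = \<alpha> + \<beta>" "expo_deg \<alpha> \<le> t" "expo_deg \<beta> \<le> t"
      using expo_split[of \<gamma> t t] \<gamma> unfolding mult_2 by blast
    have "y \<gamma> = (\<Sum>q\<in>Q. inner_on J (w \<alpha>) q * inner_on J (w \<beta>) q)"
      unfolding ab(1) Q(4)[symmetric] using ab by (intro gram) (simp_all add: I_def expos_upto_def)
    also have "\<dots> = (\<Sum>q\<in>Q. (s q)\<^sup>2 * mono_eval (v q) \<gamma>)"
      using ab by (intro sum.cong refl) (simp add: inner_gram mono_eval_add power2_eq_square mult_ac)
    finally show ?thesis .
  qed
  have interp: "s r * (\<Sum>\<alpha>\<in>I0. g q \<alpha> * mono_eval (v r) \<alpha>) = (if q = r then 1 else 0)"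
    if "q \<in> Q" "r \<in> Q" for q r
  proof -
    have q: "q u' = (\<Sum>\<gamma>\<in>I0. g q \<gamma> * w \<gamma> u')" if "u' \<in> J" for u'
    proof -
      have "(\<Sum>\<gamma>\<in>I0. g q \<gamma> * w \<gamma> u') = (\<Sum>u\<in>J. q u * (\<Sum>\<gamma>\<in>I0. G u \<gamma> * w \<gamma> u'))"
        unfolding g_def sum_distrib_left sum_distrib_right
        by (subst sum.swap) (simp add: mult_ac)
      also have "\<dots> = (\<Sum>u\<in>J. if u = u' then q u' else 0)"
        using that dual by (intro sum.cong) auto
      finally show ?thesis using that finJ by simp
    qed
    have "(if q = r then 1 else 0) = inner_on J q r" using Q(2) that by simp
    also have "\<dots> = inner_on J (\<lambda>u. \<Sum>\<gamma>\<in>I0. g q \<gamma> * w \<gamma> u) r"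
      by (intro inner_on_cong q refl)
    also have "\<dots> = (\<Sum>\<gamma>\<in>I0. g q \<gamma> * inner_on J (w \<gamma>) r)" by (rule inner_on_sum_left)
    also have "\<dots> = (\<Sum>\<gamma>\<in>I0. g q \<gamma> * (mono_eval (v r) \<gamma> * s r))"
      using sub by (intro sum.cong refl) (simp add: inner_gram[OF that(2)] I_def expos_upto_def subset_iff)
    finally show ?thesis by (simp add: sum_distrib_left mult_ac)
  qed
  show ?thesis
  proof (rule that[of Q "\<lambda>q. (s q)\<^sup>2" v g])
    fix q r assume "q \<in> Q" "r \<in> Q"
    then show "(s r)\<^sup>2 * (\<Sum>\<alpha>\<in>expos_upto (t - d). g q \<alpha> * mono_eval (v r) \<alpha>)\<^sup>2 = (if q = r then 1 else 0)"
      using interp[of q r] unfolding I0_def by (simp flip: power_mult_distrib)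
  qed (use Q(1) rep in auto)
qed

section \<open>Feasibility and concavity\<close>

lemma log_ext_mono: "s \<le> t \<Longrightarrow> log_ext s \<le> log_ext t"
  by (simp add: log_ext_def)

lemma log_sum_mono:
  assumes "\<And>i. i \<in> {1..m} \<Longrightarrow> 0 < a i" "\<And>i. i \<in> {1..m} \<Longrightarrow> w i \<le> w' i"
  shows "log_sum m a w \<le> log_sum m a w'"
  unfolding log_sum_def
  using assms by (intro sum_mono ereal_mult_left_mono log_ext_mono) (auto simp: less_imp_le)

lemma half_deg_le_rel_deg:
  assumes "finite E" "finite I" "q \<in> p ` {1..m} \<union> c ` (E \<union> I)"
  shows "half_deg q \<le> rel_deg m p E I c"
  unfolding rel_deg_def using assms by (intro Max_ge) auto

lemma one_le_rel_deg: "finite E \<Longrightarrow> finite I \<Longrightarrow> 1 \<le> rel_deg m p E I c"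
  unfolding rel_deg_def by (intro Max_ge) auto

text \<open>
  Jensen's inequality for each \<open>p i\<close>; the weights \<open>a i\<close> are positive and the logarithm is monotone, also
  at the convention \<open>-\<infinity>\<close>, so it passes to the objective.
\<close>

lemma jensen_log_mom_obj:
  fixes p :: "nat \<Rightarrow> 'n::finite rpoly"
  assumes a: "\<And>i. i \<in> {1..m} \<Longrightarrow> 0 < a i"
    and conc: "\<And>i. i \<in> {1..m} \<Longrightarrow> concave_on K (poly_eval (p i))"
    and deg: "\<And>i. i \<in> {1..m} \<Longrightarrow> poly_deg (p i) \<le> D"
    and Q: "finite Q" "\<And>q. q \<in> Q \<Longrightarrow> 0 \<le> l q" "sum l Q = 1" "\<And>q. q \<in> Q \<Longrightarrow> v q \<in> K"
    and z: "\<And>\<gamma>. expo_deg \<gamma> \<le> D \<Longrightarrow> z \<gamma> = (\<Sum>q\<in>Q. l q * mono_eval (v q) \<gamma>)"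
  shows "log_mom_obj m a p z \<le> log_poly_obj m a p (\<Sum>q\<in>Q. l q *\<^sub>R v q)"
  unfolding log_mom_obj_def log_poly_obj_def
proof (rule log_sum_mono[OF a])
  fix i assume i: "i \<in> {1..m}"
  have "Q \<noteq> {}" using Q(3) by auto
  have "riesz (p i) z = (\<Sum>q\<in>Q. l q * poly_eval (p i) (v q))"
    by (intro riesz_atoms z) (use expo_deg_le_poly_deg deg[OF i] order_trans in blast)
  also have "\<dots> \<le> poly_eval (p i) (\<Sum>q\<in>Q. l q *\<^sub>R v q)"
    using Q by (intro concave_on_sum[OF Q(1) \<open>Q \<noteq> {}\<close> conc[OF i]]) auto
  finally show "riesz (p i) z \<le> poly_eval (p i) (\<Sum>q\<in>Q. l q *\<^sub>R v q)" .
qed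

lemma moment_vec_atom:
  "expo_deg \<gamma> \<le> k \<Longrightarrow> moment_vec k x \<gamma> = (\<Sum>u\<in>{()}. 1 * mono_eval x \<gamma>)"
  by (simp add: moment_vec_def expos_upto_def)

lemma log_mom_obj_moment_vec:
  assumes "\<And>i. i \<in> {1..m} \<Longrightarrow> poly_deg (p i) \<le> k"
  shows "log_mom_obj m a p (moment_vec k x) = log_poly_obj m a p x"
proof -
  have "riesz (p i) (moment_vec k x) = poly_eval (p i) x" if "i \<in> {1..m}" for i
    unfolding riesz_def poly_eval_def
  proof (rule sum.cong[OF refl])
    fix \<alpha> assume "\<alpha> \<in> Poly_Mapping.keys (p i)"
    then have "expo_deg \<alpha> \<le> k"
      using expo_deg_le_poly_deg assms[OF that] order_trans by blast
    then show "Poly_Mapping.lookup (p i) \<alpha> * moment_vec k x \<alpha> = Poly_Mapping.lookup (p i) \<alpha> * mono_eval x \<alpha>"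
      by (simp add: moment_vec_def expos_upto_def)
  qed
  then show ?thesis
    by (simp add: log_mom_obj_def log_poly_obj_def log_sum_def)
qed

lemma mat_psd_loc_mat_moment_vec:
  assumes "poly_deg q + 2 * s \<le> k" "0 \<le> poly_eval q x"
  shows "mat_psd (expos_upto s) (loc_mat q (moment_vec k x))"
proof -
  have "loc_mat q y \<alpha> \<beta> = loc_mat q y \<beta> \<alpha>" for y \<alpha> \<beta>
    by (simp add: loc_mat_eq add_ac)
  moreover have "0 \<le> (\<Sum>\<alpha>\<in>expos_upto s. \<Sum>\<beta>\<in>expos_upto s. u \<alpha> * loc_mat q (moment_vec k x) \<alpha> \<beta> * u \<beta>)" for u
    using assms(2)
    by (subst loc_mat_form_atoms[where v = "\<lambda>_. x", OF moment_vec_atom assms(1)]) simp_all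
  ultimately show ?thesis by (simp add: mat_psd_def)
qed

text \<open>
  For a point evaluation at \<open>x\<close>, the localizing matrix of \<open>q\<close> is the value of \<open>q\<close> at \<open>x\<close> times a
  matrix of rank one.
\<close>

lemma moment_vec_rel_feas:
  assumes x: "x \<in> feas_set E I c" and deg: "\<And>j. j \<in> E \<union> I \<Longrightarrow> half_deg (c j) \<le> k"
  shows "moment_vec (2 * k) x \<in> rel_feas E I c k"
proof -
  have d: "poly_deg (c j) + 2 * (k - half_deg (c j)) \<le> 2 * k" if "j \<in> E \<union> I" for j
    using poly_deg_le_half_deg[of "c j"] deg[OF that] by linarith
  have "mat_psd (expos_upto k) (moment_mat (moment_vec (2 * k) x))"
    unfolding moment_mat_eq_loc_mat by (rule mat_psd_loc_mat_moment_vec) simp_all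
  moreover have "mat_psd (expos_upto (k - half_deg (c j))) (loc_mat (c j) (moment_vec (2 * k) x))"
    if "j \<in> I" for j
    using that x d by (intro mat_psd_loc_mat_moment_vec) (auto simp: feas_set_def)
  moreover have "mat_zero (expos_upto (k - half_deg (c j))) (loc_mat (c j) (moment_vec (2 * k) x))"
    if "j \<in> E" for j
    unfolding mat_zero_def
  proof (intro ballI)
    fix \<alpha> \<beta> :: "'a expo"
    assume "\<alpha> \<in> expos_upto (k - half_deg (c j))" "\<beta> \<in> expos_upto (k - half_deg (c j))"
    then have "poly_deg (c j) + expo_deg \<alpha> + expo_deg \<beta> \<le> 2 * k"
      using d[of j] that by (simp add: expos_upto_def)
    then show "loc_mat (c j) (moment_vec (2 * k) x) \<alpha> \<beta> = 0"
      using that x by (simp add: loc_mat_atoms[OF moment_vec_atom] feas_set_def)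
  qed
  ultimately show ?thesis
    by (simp add: rel_feas_def tms_def moment_vec_def expos_upto_def)
qed

lemma moment_vec_in_moment_cone:
  assumes "x \<in> K"
  shows "moment_vec (2 * d) x \<in> moment_cone d K"
proof -
  have "moment_vec (2 * d) x = restrict (\<lambda>\<alpha>. \<Sum>j=1..1::nat. 1 * moment_vec (2 * d) x \<alpha>) (expos_upto (2 * d))"
    by (auto simp: moment_vec_def restrict_def)
  with assms show ?thesis
    unfolding moment_cone_def
    by (intro CollectI exI[of _ "\<lambda>_. 1"] exI[of _ "\<lambda>_. x"] exI[of _ "1::nat"]) auto
qed

text \<open>
  Feasibility of the atoms: at the interpolation polynomial of the atom \<open>v q\<close>, the quadratic form
  of the localizing matrix of \<open>c j\<close> is exactly \<open>poly_eval (c j) (v q)\<close>.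
\<close>

lemma flat_moment_atoms_feasible:
  fixes y :: "'n::finite expo \<Rightarrow> real" and c :: "'l \<Rightarrow> 'n rpoly"
  assumes d: "1 \<le> d" "d \<le> t" "t \<le> k"
    and deg: "\<And>j. j \<in> E \<union> I \<Longrightarrow> half_deg (c j) \<le> d"
    and y: "y \<in> rel_feas E I c k"
    and flat: "mat_rank (expos_upto t) (moment_mat y) = mat_rank (expos_upto (t - d)) (moment_mat y)"
  obtains Q :: "(('n expo \<Rightarrow> real) \<Rightarrow> real) set" and l and v :: "_ \<Rightarrow> real ^ 'n"
  where "finite Q" "\<And>q. q \<in> Q \<Longrightarrow> 0 \<le> l q" "sum l Q = 1" "\<And>q. q \<in> Q \<Longrightarrow> v q \<in> feas_set E I c"
    "\<And>\<gamma>. expo_deg \<gamma> \<le> 2 * t \<Longrightarrow> y \<gamma> = (\<Sum>q\<in>Q. l q * mono_eval (v q) \<gamma>)"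
proof -
  have "mat_psd (expos_upto k) (moment_mat y)" using y by (simp add: rel_feas_def)
  then have psd: "mat_psd (expos_upto t) (moment_mat y)"
    using expos_upto_mono[OF d(3)] by (rule mat_psd_subset) simp
  obtain Q :: "(('n expo \<Rightarrow> real) \<Rightarrow> real) set" and l and v :: "_ \<Rightarrow> real ^ 'n"
    and g :: "_ \<Rightarrow> 'n expo \<Rightarrow> real" where Q: "finite Q" "\<And>q. q \<in> Q \<Longrightarrow> 0 \<le> l q"
    and rep: "\<And>\<gamma>. expo_deg \<gamma> \<le> 2 * t \<Longrightarrow> y \<gamma> = (\<Sum>q\<in>Q. l q * mono_eval (v q) \<gamma>)"
    and interp: "\<And>q r. q \<in> Q \<Longrightarrow> r \<in> Q \<Longrightarrow>
      l r * (\<Sum>\<alpha>\<in>expos_upto (t - d). g q \<alpha> * mono_eval (v r) \<alpha>)\<^sup>2 = (if q = r then 1 else 0)"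
    by (rule flat_moment_atoms[OF d(1,2) psd flat]) (rule that)
  have val: "(\<Sum>\<alpha>\<in>expos_upto (t - d). \<Sum>\<beta>\<in>expos_upto (t - d). g q \<alpha> * loc_mat (c j) y \<alpha> \<beta> * g q \<beta>)
      = poly_eval (c j) (v q)" if q: "q \<in> Q" and j: "j \<in> E \<union> I" for q j
  proof -
    have "poly_deg (c j) + 2 * (t - d) \<le> 2 * t"
      using poly_deg_le_half_deg[of "c j"] deg[OF j] d by linarith
    then have "(\<Sum>\<alpha>\<in>expos_upto (t - d). \<Sum>\<beta>\<in>expos_upto (t - d). g q \<alpha> * loc_mat (c j) y \<alpha> \<beta> * g q \<beta>)
      = (\<Sum>r\<in>Q. l r * poly_eval (c j) (v r) * (\<Sum>\<alpha>\<in>expos_upto (t - d). g q \<alpha> * mono_eval (v r) \<alpha>)\<^sup>2)"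
      using rep by (intro loc_mat_form_atoms) auto
    also have "\<dots> = (\<Sum>r\<in>Q. poly_eval (c j) (v r) * (if q = r then 1 else 0))"
      using q by (intro sum.cong refl) (simp add: interp[symmetric])
    also have "\<dots> = poly_eval (c j) (v q)"
      using q Q(1) by (simp add: if_distrib cong: if_cong)
    finally show ?thesis .
  qed
  have sub: "expos_upto (t - d) \<subseteq> (expos_upto (k - half_deg (c j)) :: 'n expo set)" if "j \<in> E \<union> I" for j
    using deg[OF that] d by (intro expos_upto_mono) simp
  have "poly_eval (c j) (v q) = 0" if "q \<in> Q" "j \<in> E" for q j
  proof -
    have "loc_mat (c j) y \<alpha> \<beta> = 0" if "\<alpha> \<in> expos_upto (t - d)" "\<beta> \<in> expos_upto (t - d)" for \<alpha> \<beta>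
      using y \<open>j \<in> E\<close> that sub[of j] unfolding rel_feas_def mat_zero_def by blast
    with val[of q j] that show ?thesis by simp
  qed
  moreover have "poly_eval (c j) (v q) \<ge> 0" if "q \<in> Q" "j \<in> I" for q j
  proof -
    have "mat_psd (expos_upto (k - half_deg (c j))) (loc_mat (c j) y)"
      using y that by (simp add: rel_feas_def)
    then have "mat_psd (expos_upto (t - d)) (loc_mat (c j) y)"
      using sub[of j] that by (auto intro: mat_psd_subset[OF _ sub])
    then have "0 \<le> (\<Sum>\<alpha>\<in>expos_upto (t - d). \<Sum>\<beta>\<in>expos_upto (t - d). g q \<alpha> * loc_mat (c j) y \<alpha> \<beta> * g q \<beta>)"
      by (simp add: mat_psd_def)
    with val[of q j] that show ?thesis by simp
  qed
  ultimately have K: "v q \<in> feas_set E I c" if "q \<in> Q" for q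
    using that by (simp add: feas_set_def)
  have "sum l Q = 1" using rep[of 0] y by (simp add: rel_feas_def)
  from Q this K rep show ?thesis by (rule that)
qed

section \<open>Tightness of the relaxation\<close>

theorem theorem4p4:
  fixes m k :: nat
    and a :: "nat \<Rightarrow> real"
    and p :: "nat \<Rightarrow> 'n::finite rpoly"
    and E I :: "'l set"
    and c :: "'l \<Rightarrow> 'n rpoly"
    and ystar :: "'n expo \<Rightarrow> real"
    and xhat :: "real ^ 'n"
  assumes "m \<ge> 1"
    and "\<And>i. i \<in> {1..m} \<Longrightarrow> a i > 0"
    and "finite E" and "finite I" and "E \<inter> I = {}"
    and "\<And>i x. i \<in> {1..m} \<Longrightarrow> x \<in> feas_set E I c \<Longrightarrow> poly_eval (p i) x \<ge> 0"
    and "xhat \<in> feas_set E I c"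
    and "\<And>i. i \<in> {1..m} \<Longrightarrow> poly_eval (p i) xhat > 0"
    and "convex (feas_set E I c)"
    and "\<And>i. i \<in> {1..m} \<Longrightarrow> concave_on (feas_set E I c) (poly_eval (p i))"
    and "k \<ge> rel_deg m p E I c"
    and "is_arg_max (log_mom_obj m a p) (\<lambda>y. y \<in> rel_feas E I c k) ystar"
    and "flat_trunc (rel_deg m p E I c) k ystar"
  shows "f_max m a p E I c = f_mom m a p E I c
       \<and> f_mom m a p E I c = f_mom_rel m a p E I c k
       \<and> is_arg_max (log_poly_obj m a p) (\<lambda>x. x \<in> feas_set E I c) (\<chi> i. ystar (unit_expo i))"
proof -
  define K where "K = feas_set E I c"
  define d where "d = rel_deg m p E I c"
  note a = assms(2) and conv = assms(9)[folded K_def] and conc = assms(10)[folded K_def]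
  have d1: "1 \<le> d" unfolding d_def using assms(3,4) by (rule one_le_rel_deg)
  have dk: "d \<le> k" using assms(11) by (simp add: d_def)
  have deg_p: "poly_deg (p i) \<le> 2 * d" if "i \<in> {1..m}" for i
    using half_deg_le_rel_deg[OF assms(3,4), of "p i" p m c] poly_deg_le_half_deg[of "p i"] that
    by (simp add: d_def)
  have deg_c: "half_deg (c j) \<le> d" if "j \<in> E \<union> I" for j
    unfolding d_def using that by (intro half_deg_le_rel_deg assms(3,4)) auto
  have ystar: "ystar \<in> rel_feas E I c k"
    using assms(12) by (simp add: is_arg_max_def)
  have ymax: "log_mom_obj m a p y \<le> log_mom_obj m a p ystar" if "y \<in> rel_feas E I c k" for y
    using assms(12) that by (auto simp: is_arg_max_def not_less)
  have max_le_mom: "f_max m a p E I c \<le> f_mom m a p E I c"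
    unfolding f_max_def
  proof (rule SUP_least)
    fix x assume x: "x \<in> feas_set E I c"
    have "moment_vec (2 * d) x \<in> mom_feas m p E I c"
      using moment_vec_in_moment_cone[OF x, of d]
      by (simp add: mom_feas_def d_def moment_vec_def expos_upto_def)
    then have "log_mom_obj m a p (moment_vec (2 * d) x) \<le> f_mom m a p E I c"
      unfolding f_mom_def by (rule SUP_upper)
    then show "log_poly_obj m a p x \<le> f_mom m a p E I c"
      by (simp only: log_mom_obj_moment_vec[of m p "2 * d", OF deg_p])
  qed
  have max_le_rel: "f_max m a p E I c \<le> f_mom_rel m a p E I c k"
    unfolding f_max_def
  proof (rule SUP_least)
    fix x assume x: "x \<in> feas_set E I c"
    have "moment_vec (2 * k) x \<in> rel_feas E I c k"
      using deg_c dk by (intro moment_vec_rel_feas x) (meson order_trans)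
    then have "log_mom_obj m a p (moment_vec (2 * k) x) \<le> f_mom_rel m a p E I c k"
      unfolding f_mom_rel_def by (rule SUP_upper)
    moreover have "poly_deg (p i) \<le> 2 * k" if "i \<in> {1..m}" for i
      using deg_p[OF that] dk by linarith
    then have "log_mom_obj m a p (moment_vec (2 * k) x) = log_poly_obj m a p x"
      by (rule log_mom_obj_moment_vec)
    ultimately show "log_poly_obj m a p x \<le> f_mom_rel m a p E I c k"
      by (simp only:)
  qed
  have mom_le_max: "f_mom m a p E I c \<le> f_max m a p E I c"
    unfolding f_mom_def
  proof (rule SUP_least)
    fix z assume "z \<in> mom_feas m p E I c"
    then obtain w v and l :: nat where z: "z 0 = 1"
      "z = restrict (\<lambda>\<alpha>. \<Sum>j=1..l. w j * moment_vec (2 * d) (v j) \<alpha>) (expos_upto (2 * d))"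
      and wv: "\<forall>j\<in>{1..l}. w j \<ge> 0 \<and> v j \<in> K"
      by (auto simp: mom_feas_def moment_cone_def d_def K_def)
    have rep: "z \<gamma> = (\<Sum>j\<in>{1..l}. w j * mono_eval (v j) \<gamma>)" if "expo_deg \<gamma> \<le> 2 * d" for \<gamma>
      using that by (simp add: z(2) moment_vec_def expos_upto_def)
    have w1: "sum w {1..l} = 1" using rep[of 0] z(1) by simp
    have "log_mom_obj m a p z \<le> log_poly_obj m a p (\<Sum>j\<in>{1..l}. w j *\<^sub>R v j)"
      by (rule jensen_log_mom_obj[OF a conc deg_p _ _ w1 _ rep]) (use wv in auto)
    also have "\<dots> \<le> f_max m a p E I c"
    proof -
      have "(\<Sum>j\<in>{1..l}. w j *\<^sub>R v j) \<in> K"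
        using wv by (intro convex_sum conv w1) auto
      then show ?thesis unfolding f_max_def K_def by (rule SUP_upper)
    qed
    finally show "log_mom_obj m a p z \<le> f_max m a p E I c" .
  qed
  obtain t where t: "d \<le> t" "t \<le> k"
    and flat: "mat_rank (expos_upto t) (moment_mat ystar) = mat_rank (expos_upto (t - d)) (moment_mat ystar)"
    using assms(13) by (auto simp: flat_trunc_def d_def)
  obtain Q :: "(('n expo \<Rightarrow> real) \<Rightarrow> real) set" and l and v :: "_ \<Rightarrow> real ^ 'n"
    where Q: "finite Q" "\<And>q. q \<in> Q \<Longrightarrow> 0 \<le> l q" "sum l Q = 1" "\<And>q. q \<in> Q \<Longrightarrow> v q \<in> K"
    and rep: "\<And>\<gamma>. expo_deg \<gamma> \<le> 2 * t \<Longrightarrow> ystar \<gamma> = (\<Sum>q\<in>Q. l q * mono_eval (v q) \<gamma>)"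
    by (rule flat_moment_atoms_feasible[OF d1 t deg_c ystar flat, folded K_def])
       (assumption | rule that)+
  define vstar where "vstar = (\<chi> i. ystar (unit_expo i))"
  have vstar: "vstar = (\<Sum>q\<in>Q. l q *\<^sub>R v q)"
    using d1 t by (simp add: vstar_def vec_eq_iff rep)
  have vK: "vstar \<in> K"
    unfolding vstar using Q by (intro convex_sum conv)
  have "log_mom_obj m a p ystar \<le> log_poly_obj m a p vstar"
    unfolding vstar using t(1)
    by (intro jensen_log_mom_obj[OF a conc deg_p Q] rep) auto
  moreover have "f_mom_rel m a p E I c k \<le> log_mom_obj m a p ystar"
    unfolding f_mom_rel_def by (intro SUP_least ymax)
  ultimately have rel_le: "f_mom_rel m a p E I c k \<le> log_poly_obj m a p vstar" by simp
  have v_le: "log_poly_obj m a p x \<le> f_max m a p E I c" if "x \<in> K" for x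
    using that unfolding f_max_def K_def by (rule SUP_upper)
  have "f_max m a p E I c = f_mom m a p E I c"
    using max_le_mom mom_le_max by (rule antisym)
  moreover have "f_max m a p E I c = f_mom_rel m a p E I c k"
    using max_le_rel rel_le v_le[OF vK] by auto
  moreover have "is_arg_max (log_poly_obj m a p) (\<lambda>x. x \<in> K) vstar"
    using vK v_le rel_le max_le_rel unfolding is_arg_max_def
    by (meson leD order_trans)
  ultimately show ?thesis
    by (simp add: vstar_def K_def)
qed

end
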